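(* Let $X$ be a real Banach space and let $\tau=\tau(X^*,X)$ be the Mackey topology on $X^*$. Then $X$ is sequentially reflexive if and only if the finest locally convex topology $\tau^{p}$ on $X^{*}$ with the same precompact sets as $\tau$ is the bound extension $\tau^{b}$ of $\tau$.
   Context: The Mackey topology $\tau(X^*,X)$ on $X^*$ is the topology of uniform convergence on all weakly compact absolutely convex subsets of $X$. A Banach space $X$ is sequentially reflexive if every $\tau(X^*,X)$-convergent sequence in $X^*$ is norm convergent. Precompact means totally bounded. For a Hausdorff locally convex space $(E,\tau)$, the bound extension $\tau^b$ of $\tau$ is the locally convex topology whose local base at $0$ consists of all circled convex subsets of $E$ that absorb every $\tau$-bounded subset of $E$. *)

theory Defs
  imports "HOL-Analysis.Analysis"
begin

section \<open>Locally convex topologies on a real vector space\<close>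

text \<open>Several vector topologies on the same space are compared, so they are values of type
  \<open>'a topology\<close> rather than type class instances.\<close>

definition circled :: "'a::real_vector set \<Rightarrow> bool" where
  "circled S \<longleftrightarrow> (\<forall>c::real. \<bar>c\<bar> \<le> 1 \<longrightarrow> (\<lambda>x. c *\<^sub>R x) ` S \<subseteq> S)"

definition absolutely_convex :: "'a::real_vector set \<Rightarrow> bool" where
  "absolutely_convex S \<longleftrightarrow> convex S \<and> circled S"

definition absorbs :: "'a::real_vector set \<Rightarrow> 'a set \<Rightarrow> bool" where
  "absorbs V B \<longleftrightarrow> (\<exists>r>0. \<forall>c::real. \<bar>c\<bar> \<ge> r \<longrightarrow> B \<subseteq> (\<lambda>x. c *\<^sub>R x) ` V)"

definition locally_convex_topology :: "'a::real_vector topology \<Rightarrow> bool" where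
  "locally_convex_topology T \<longleftrightarrow>
     topspace T = UNIV \<and>
     continuous_map (prod_topology T T) T (\<lambda>(x, y). x + y) \<and>
     continuous_map (prod_topology euclideanreal T) T (\<lambda>(c, x). c *\<^sub>R x) \<and>
     (\<forall>U. openin T U \<and> 0 \<in> U \<longrightarrow> (\<exists>V. openin T V \<and> 0 \<in> V \<and> convex V \<and> V \<subseteq> U))"

definition bounded_in :: "'a::real_vector topology \<Rightarrow> 'a set \<Rightarrow> bool" where
  "bounded_in T B \<longleftrightarrow> (\<forall>U. openin T U \<and> 0 \<in> U \<longrightarrow> absorbs U B)"

definition precompact_in :: "'a::real_vector topology \<Rightarrow> 'a set \<Rightarrow> bool" where
  "precompact_in T S \<longleftrightarrow>
     (\<forall>U. openin T U \<and> 0 \<in> U \<longrightarrow> (\<exists>F. finite F \<and> S \<subseteq> (\<Union>x\<in>F. (+) x ` U)))"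

text \<open>The translation-invariant topology with local base \<open>\<B>\<close> at \<open>0\<close>;
  \<open>\<B>\<close> has to be a filter base, see \<open>openin_topology_of_local_base\<close>.\<close>

definition topology_of_local_base :: "'a::real_vector set set \<Rightarrow> 'a topology" where
  "topology_of_local_base \<B> = topology (\<lambda>U. \<forall>x\<in>U. \<exists>V\<in>\<B>. (+) x ` V \<subseteq> U)"

lemma openin_topology_of_local_base:
  assumes "\<B> \<noteq> {}" and "\<And>V W. V \<in> \<B> \<Longrightarrow> W \<in> \<B> \<Longrightarrow> \<exists>Z\<in>\<B>. Z \<subseteq> V \<inter> W"
  shows "openin (topology_of_local_base \<B>) U \<longleftrightarrow> (\<forall>x\<in>U. \<exists>V\<in>\<B>. (+) x ` V \<subseteq> U)"
proof -
  have "istopology (\<lambda>U. \<forall>x\<in>U. \<exists>V\<in>\<B>. (+) x ` V \<subseteq> U)"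
    unfolding istopology_def
  proof (intro conjI allI impI ballI)
    fix S T x
    assume S: "\<forall>x\<in>S. \<exists>V\<in>\<B>. (+) x ` V \<subseteq> S" and T: "\<forall>x\<in>T. \<exists>V\<in>\<B>. (+) x ` V \<subseteq> T"
      and x: "x \<in> S \<inter> T"
    obtain V W where VW: "V \<in> \<B>" "W \<in> \<B>" "(+) x ` V \<subseteq> S" "(+) x ` W \<subseteq> T"
      using S T x by blast
    obtain Z where "Z \<in> \<B>" "Z \<subseteq> V \<inter> W"
      using assms(2) VW by blast
    then show "\<exists>V\<in>\<B>. (+) x ` V \<subseteq> S \<inter> T"
      using VW by blast
  next
    fix \<K> x
    assume "\<forall>K\<in>\<K>. \<forall>x\<in>K. \<exists>V\<in>\<B>. (+) x ` V \<subseteq> K" and "x \<in> \<Union>\<K>"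
    then show "\<exists>V\<in>\<B>. (+) x ` V \<subseteq> \<Union>\<K>"
      by (meson UnionE Union_upper subset_trans)
  qed
  then show ?thesis
    by (simp add: topology_of_local_base_def topology_inverse')
qed

definition bound_extension :: "'a::real_vector topology \<Rightarrow> 'a topology" where
  "bound_extension T = topology_of_local_base
     {V. circled V \<and> convex V \<and> (\<forall>B. bounded_in T B \<longrightarrow> absorbs V B)}"

definition finest_locally_convex_with_same_precompact_sets ::
    "'a::real_vector topology \<Rightarrow> 'a topology \<Rightarrow> bool" where
  "finest_locally_convex_with_same_precompact_sets T P \<longleftrightarrow>
     locally_convex_topology P \<and>
     (\<forall>S. precompact_in P S \<longleftrightarrow> precompact_in T S) \<and>
     (\<forall>Q. locally_convex_topology Q \<and> (\<forall>S. precompact_in Q S \<longleftrightarrow> precompact_in T S)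
          \<longrightarrow> (\<forall>U. openin Q U \<longrightarrow> openin P U))"


section \<open>The Mackey topology on the dual of a normed space\<close>

definition weak_topology :: "'a::real_normed_vector topology" where
  "weak_topology =
     topology_generated_by {blinfun_apply f -` U | (f :: 'a \<Rightarrow>\<^sub>L real) U. open U}"

definition uniform_convergence_topology ::
    "'a::real_normed_vector set set \<Rightarrow> ('a \<Rightarrow>\<^sub>L real) topology" where
  "uniform_convergence_topology \<K> = topology_of_local_base
     {{f. \<forall>K\<in>\<F>. \<forall>x\<in>K. \<bar>blinfun_apply f x\<bar> \<le> e} | \<F> e. finite \<F> \<and> \<F> \<subseteq> \<K> \<and> e > 0}"

definition mackey_dual_topology :: "('a::real_normed_vector \<Rightarrow>\<^sub>L real) topology" where
  "mackey_dual_topology =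
     uniform_convergence_topology {K. compactin weak_topology K \<and> absolutely_convex K}"

definition sequentially_reflexive :: "'a::banach itself \<Rightarrow> bool" where
  "sequentially_reflexive (_ :: 'a itself) \<longleftrightarrow>
     (\<forall>f :: nat \<Rightarrow> 'a \<Rightarrow>\<^sub>L real.
        (\<exists>l. limitin mackey_dual_topology f l sequentially) \<longrightarrow> convergent f)"


section \<open>The local bases above are filter bases\<close>

lemma absorbs_mono: "absorbs V B \<Longrightarrow> V \<subseteq> W \<Longrightarrow> absorbs W B"
  unfolding absorbs_def by (meson image_mono subset_trans)

lemma absorbs_Int:
  assumes "absorbs V B" "absorbs W B"
  shows "absorbs (V \<inter> W) B"
proof -
  obtain r s where r: "r > 0" "\<And>c::real. \<bar>c\<bar> \<ge> r \<Longrightarrow> B \<subseteq> (\<lambda>x. c *\<^sub>R x) ` V"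
    and s: "s > 0" "\<And>c::real. \<bar>c\<bar> \<ge> s \<Longrightarrow> B \<subseteq> (\<lambda>x. c *\<^sub>R x) ` W"
    using assms unfolding absorbs_def by blast
  have "B \<subseteq> (\<lambda>x. c *\<^sub>R x) ` (V \<inter> W)" if c: "\<bar>c\<bar> \<ge> max r s" for c :: real
  proof -
    have "inj (\<lambda>x::'a. c *\<^sub>R x)"
      using c r(1) by (intro injI) auto
    then have "(\<lambda>x. c *\<^sub>R x) ` (V \<inter> W) = (\<lambda>x. c *\<^sub>R x) ` V \<inter> (\<lambda>x. c *\<^sub>R x) ` W"
      by (rule image_Int)
    then show ?thesis
      using r(2)[of c] s(2)[of c] c by auto
  qed
  then show ?thesis
    unfolding absorbs_def using r(1) by (meson less_max_iff_disj)
qed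

lemma openin_bound_extension:
  "openin (bound_extension T) U \<longleftrightarrow>
     (\<forall>x\<in>U. \<exists>V. circled V \<and> convex V \<and> (\<forall>B. bounded_in T B \<longrightarrow> absorbs V B) \<and> (+) x ` V \<subseteq> U)"
proof -
  let ?\<B> = "{V. circled V \<and> convex V \<and> (\<forall>B. bounded_in T B \<longrightarrow> absorbs V B)}"
  have "B \<subseteq> range (\<lambda>x. c *\<^sub>R x)" if "\<bar>c\<bar> \<ge> 1" for B :: "'a set" and c :: real
  proof
    fix x :: 'a
    have "c \<noteq> 0"
      using that by auto
    then have "x = c *\<^sub>R (inverse c *\<^sub>R x)"
      by simp
    then show "x \<in> range (\<lambda>x. c *\<^sub>R x)"
      by blast
  qed
  then have "absorbs UNIV B" for B :: "'a set"
    unfolding absorbs_def by (meson zero_less_one)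
  then have "UNIV \<in> ?\<B>"
    by (auto simp: circled_def)
  then have ne: "?\<B> \<noteq> {}"
    by blast
  have int: "V \<inter> W \<in> ?\<B>" if "V \<in> ?\<B>" "W \<in> ?\<B>" for V W
  proof -
    have "circled (V \<inter> W)"
      using that unfolding circled_def by blast
    then show ?thesis
      using that by (simp add: convex_Int absorbs_Int)
  qed
  have "openin (bound_extension T) U \<longleftrightarrow> (\<forall>x\<in>U. \<exists>V\<in>?\<B>. (+) x ` V \<subseteq> U)"
    unfolding bound_extension_def
    by (rule openin_topology_of_local_base[OF ne]) (rule bexI[OF order_refl int])
  then show ?thesis
    by (simp add: conj_assoc)
qed

lemma openin_uniform_convergence_topology:
  "openin (uniform_convergence_topology \<K>) U \<longleftrightarrow>
     (\<forall>f\<in>U. \<exists>\<F> e. finite \<F> \<and> \<F> \<subseteq> \<K> \<and> e > 0 \<and>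
        (\<forall>g. (\<forall>K\<in>\<F>. \<forall>x\<in>K. \<bar>blinfun_apply g x - blinfun_apply f x\<bar> \<le> e) \<longrightarrow> g \<in> U))"
proof -
  define N where
    "N \<F> e = {f :: 'a \<Rightarrow>\<^sub>L real. \<forall>K\<in>\<F>. \<forall>x\<in>K. \<bar>blinfun_apply f x\<bar> \<le> e}" for \<F> e
  let ?\<B> = "{N \<F> e | \<F> e. finite \<F> \<and> \<F> \<subseteq> \<K> \<and> e > 0}"
  have "N {} 1 \<in> ?\<B>"
    by (intro CollectI exI[of _ "{}"] exI[of _ 1]) auto
  then have ne: "?\<B> \<noteq> {}"
    by blast
  have dir: "\<exists>Z\<in>?\<B>. Z \<subseteq> V \<inter> W" if VW: "V \<in> ?\<B>" "W \<in> ?\<B>" for V W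
  proof -
    obtain \<F> e \<G> d where *: "V = N \<F> e" "finite \<F>" "\<F> \<subseteq> \<K>" "e > 0"
      "W = N \<G> d" "finite \<G>" "\<G> \<subseteq> \<K>" "d > 0"
      using VW by blast
    have "N (\<F> \<union> \<G>) (min e d) \<in> ?\<B>"
      using * by (intro CollectI exI[of _ "\<F> \<union> \<G>"] exI[of _ "min e d"]) auto
    moreover have "N (\<F> \<union> \<G>) (min e d) \<subseteq> V \<inter> W"
      unfolding * N_def by auto
    ultimately show ?thesis
      by blast
  qed
  have sub: "(+) f ` N \<F> e \<subseteq> U \<longleftrightarrow>
      (\<forall>g. (\<forall>K\<in>\<F>. \<forall>x\<in>K. \<bar>blinfun_apply g x - blinfun_apply f x\<bar> \<le> e) \<longrightarrow> g \<in> U)" for f \<F> e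
  proof -
    have "(+) f ` N \<F> e = {g. g - f \<in> N \<F> e}"
    proof (intro set_eqI iffI)
      fix g assume "g \<in> {g. g - f \<in> N \<F> e}"
      moreover have "g = f + (g - f)"
        by simp
      ultimately show "g \<in> (+) f ` N \<F> e"
        by blast
    qed auto
    then show ?thesis
      by (simp only: subset_iff N_def mem_Collect_eq blinfun.diff_left)
  qed
  have "openin (uniform_convergence_topology \<K>) U \<longleftrightarrow> (\<forall>f\<in>U. \<exists>V\<in>?\<B>. (+) f ` V \<subseteq> U)"
    unfolding uniform_convergence_topology_def N_def[symmetric]
    by (rule openin_topology_of_local_base[OF ne dir])
  also have "\<dots> \<longleftrightarrow> (\<forall>f\<in>U. \<exists>\<F> e. finite \<F> \<and> \<F> \<subseteq> \<K> \<and> e > 0 \<and> (+) f ` N \<F> e \<subseteq> U)"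
    by (simp only: bex_simps mem_Collect_eq Bex_def ex_simps) metis
  finally show ?thesis
    unfolding sub .
qed

end

(* Bounded sets of the Mackey topology are the norm bounded sets, by two applications of the uniform
   boundedness principle, so the bound extension is the norm topology.  A Mackey convergent sequence
   is Mackey precompact, and a norm precompact sequence that converges pointwise converges in norm;
   this gives one implication.

   Conversely, let X be sequentially reflexive.  A locally convex topology whose precompact sets
   include the norm precompact ones is coarser than the norm topology, so it remains to show that a
   Mackey precompact set S is norm precompact.  Otherwise the unit ball of X contains a sequence
   separated uniformly on S.  None of its subsequences is weakly Cauchy, because S is uniformly small
   on the tail of a weakly null sequence.  By Rosenthal's dichotomy a subsequence x_n is independent
   on the dual ball: functionals g realise every pattern of "g x_n >= b" and "g x_n <= a".
   Integrating Rademacher signs against these functionals, for a finitely additive mean on the dual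
   ball, gives functionals h_n with h_n x_n >= (b - a)/2.  They are pointwise null by Bessel's
   inequality, and uniformly null on weakly compact sets since the map of X into L^1 of the mean
   takes weakly null sequences of a weakly compact set to null sequences.  So h_n is Mackey null but
   not norm null, contradicting sequential reflexivity. *)

theory Submission
  imports Defs
begin

section \<open>Ultrafilters and uniform boundedness\<close>

text \<open>The difficulty is that the functionals \<open>h n\<close> must be small on all weakly
  compact sets at once and yet large at \<open>x n\<close>. They are therefore built so as to be
  dominated by one seminorm p, where p x is the mean of |g x| over g in the dual ball; only p then
  has to be studied on weakly compact sets. If p stays large along differences
  \<open>c n - c0\<close> that tend weakly to 0, the sets of functionals large at these differences
  have mean bounded below. Such sets have enough common points to build a double sequence that
  violates the interchange of iterated limits on a weakly compact set. Ultrafilters supply the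
  limits throughout: weak limits of points of a weakly compact set, pointwise limits of functionals,
  and the mean itself, as a limit of averages over the 2^N sign patterns of length N. Independence
  is thus needed in its finite form, with one gap (a, b) for all patterns.\<close>

definition ultra_on :: "'a filter \<Rightarrow> bool" where
  "ultra_on U \<longleftrightarrow> U \<noteq> bot \<and> (\<forall>P. eventually P U \<or> eventually (\<lambda>x. \<not> P x) U)"

text \<open>Zorn's lemma for the reversed order of filters gives a minimal proper filter below
  \<open>F\<close>. Unless the negation of \<open>P\<close> holds eventually, adding
  \<open>P\<close> leaves it proper, so by minimality \<open>P\<close> holds already.\<close>

lemma ultrafilter_exists:
  assumes "F \<noteq> bot"
  obtains U where "U \<le> F" "ultra_on U"
proof -
  let ?A = "{G. G \<noteq> bot \<and> G \<le> F}"
  let ?P = "\<lambda>G H :: 'a filter. H \<le> G"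
  have "\<exists>m \<in> ?A. \<forall>a \<in> ?A. ?P m a \<longrightarrow> a = m"
  proof (rule predicate_Zorn)
    show "partial_order_on ?A (relation_of ?P ?A)"
      by (rule partial_order_on_relation_ofI) auto
  next
    fix C assume C: "C \<in> Chains (relation_of ?P ?A)"
    then have sub: "C \<subseteq> ?A" and lin: "\<And>a b. a \<in> C \<Longrightarrow> b \<in> C \<Longrightarrow> a \<le> b \<or> b \<le> a"
      by (auto simp: Chains_def relation_of_def)
    show "\<exists>u\<in>?A. \<forall>a\<in>C. u \<le> a"
    proof (cases "C = {}")
      case True
      then show ?thesis using assms by auto
    next
      case False
      \<comment> \<open>A chain is directed, so its members form a base of its infimum, which is
        improper only if a member is.\<close>
      have "\<exists>x\<in>C. x \<le> inf a b" if "a \<in> C" "b \<in> C" for a b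
        using lin[OF that] that by (auto simp: inf_absorb1 inf_absorb2)
      then have "eventually (\<lambda>_. False) (Inf C) \<longleftrightarrow> (\<exists>b\<in>C. eventually (\<lambda>_. False) b)"
        using False by (intro eventually_Inf_base) auto
      then have "Inf C \<noteq> bot"
        using sub by (auto simp: trivial_limit_def)
      moreover have "Inf C \<le> F"
        using False sub by (auto intro: Inf_lower2)
      ultimately show ?thesis
        by (auto intro: Inf_lower)
    qed
  qed
  then obtain U where U: "U \<noteq> bot" "U \<le> F" and max: "\<And>G. G \<noteq> bot \<Longrightarrow> G \<le> U \<Longrightarrow> G = U"
    by (auto intro: order_trans)
  have "eventually P U \<or> eventually (\<lambda>x. \<not> P x) U" for P
  proof (rule disjCI)
    assume "\<not> eventually (\<lambda>x. \<not> P x) U"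
    then have "inf U (principal {x. P x}) \<noteq> bot"
      by (simp add: trivial_limit_def eventually_inf_principal)
    then have eq: "inf U (principal {x. P x}) = U"
      by (rule max) simp
    have "eventually P (inf U (principal {x. P x}))"
      by (simp add: eventually_inf_principal)
    then show "eventually P U"
      by (simp only: eq)
  qed
  with U that show thesis by (auto simp: ultra_on_def)
qed

lemma ultra_onD: "ultra_on U \<Longrightarrow> \<not> eventually P U \<longleftrightarrow> eventually (\<lambda>x. \<not> P x) U"
  unfolding ultra_on_def
  using eventually_conj[of P U "\<lambda>x. \<not> P x"] by (auto simp: trivial_limit_def)

text \<open>Compactness yields a cluster point, and an ultrafilter converges to each of its cluster
  points.\<close>

lemma ultra_on_tendsto_compact:
  assumes U: "ultra_on U" and "compact K" and ev: "eventually (\<lambda>n. f n \<in> K) U"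
  obtains l where "l \<in> K" "(f \<longlongrightarrow> l) U"
proof -
  have "filtermap f U \<noteq> bot" "eventually (\<lambda>x. x \<in> K) (filtermap f U)"
    using U ev by (auto simp: ultra_on_def filtermap_bot_iff eventually_filtermap)
  then obtain l where l: "l \<in> K" "inf (nhds l) (filtermap f U) \<noteq> bot"
    using \<open>compact K\<close> unfolding compact_filter by metis
  have "eventually (\<lambda>n. f n \<in> S) U" if "open S" "l \<in> S" for S
  proof (rule ccontr)
    assume "\<not> ?thesis"
    then have "eventually (\<lambda>n. f n \<notin> S) U" using ultra_onD[OF U] by blast
    then have "eventually (\<lambda>_. False) (inf (nhds l) (filtermap f U))"
      unfolding eventually_inf using that
      by (intro exI[of _ "\<lambda>x. x \<in> S"] exI[of _ "\<lambda>x. x \<notin> S"])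
         (auto simp: eventually_filtermap eventually_nhds)
    with l show False by (simp add: trivial_limit_def)
  qed
  then show thesis using l(1) by (intro that) (auto simp: tendsto_def)
qed

lemma ultra_on_tendsto_bounded:
  fixes f :: "'a \<Rightarrow> real"
  assumes "ultra_on U" and "\<And>n. \<bar>f n\<bar> \<le> c"
  shows "(f \<longlongrightarrow> Lim U f) U" "\<bar>Lim U f\<bar> \<le> c"
proof -
  obtain l where l: "l \<in> {-c..c}" "(f \<longlongrightarrow> l) U"
    using ultra_on_tendsto_compact[of U "{-c..c}" f] assms
    by (auto simp: abs_le_iff minus_le_iff)
  moreover have "U \<noteq> bot" using assms by (simp add: ultra_on_def)
  ultimately have "Lim U f = l" by (intro tendsto_Lim)
  with l show "(f \<longlongrightarrow> Lim U f) U" "\<bar>Lim U f\<bar> \<le> c" by auto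
qed

section \<open>Uniform boundedness for functionals on a Banach space\<close>

lemma blinfun_scaleR_norm_bound:
  fixes T :: "'a::real_normed_vector \<Rightarrow>\<^sub>L real"
  assumes r: "0 < r" and "\<And>u. norm u \<le> r \<Longrightarrow> \<bar>T u\<bar> \<le> c"
  shows "norm T \<le> c / r"
proof (rule norm_blinfun_bound)
  show "0 \<le> c / r" using assms(2)[of 0] r by simp
  fix x show "norm (T x) \<le> c / r * norm x"
  proof (cases "x = 0")
    case False
    have "\<bar>T ((r / norm x) *\<^sub>R x)\<bar> \<le> c"
      using False r by (intro assms(2)) simp
    then show ?thesis using False r
      by (simp add: blinfun.scaleR_right abs_mult field_simps)
  qed simp
qed

text \<open>Baire category: one of the closed sets \<open>A n\<close> contains a ball. The lemma is
  applied both on \<open>'a\<close> and on its dual, there to evaluations at points.\<close>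

lemma uniform_boundedness:
  fixes F :: "('a::banach \<Rightarrow>\<^sub>L real) set"
  assumes bd: "\<And>x. \<exists>c. \<forall>T\<in>F. \<bar>T x\<bar> \<le> c"
  shows "\<exists>c. \<forall>T\<in>F. norm T \<le> c"
proof -
  define A where "A n = {x. \<forall>T\<in>F. \<bar>T x\<bar> \<le> real n}" for n
  have cl: "closed (A n)" for n
  proof -
    have "A n = (\<Inter>T\<in>F. {x. \<bar>blinfun_apply T x\<bar> \<le> real n})" by (auto simp: A_def)
    moreover have "closed {x. \<bar>T x\<bar> \<le> real n}" for T :: "'a \<Rightarrow>\<^sub>L real"
      by (intro closed_Collect_le continuous_intros)
    ultimately show ?thesis by auto
  qed
  have cov: "(\<Union>n. A n) = UNIV"
  proof (intro equalityI subsetI UNIV_I)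
    fix x obtain c where "\<forall>T\<in>F. \<bar>T x\<bar> \<le> c" using bd by blast
    moreover obtain n where "c \<le> real n" using real_arch_simple by blast
    ultimately have "x \<in> A n" by (force simp: A_def)
    then show "x \<in> (\<Union>n. A n)" by blast
  qed
  have "\<exists>n. interior (A n) \<noteq> {}"
  proof (rule ccontr)
    assume "\<not> ?thesis"
    then have "Met_TC.mtopology interior_of (\<Union>(range A)) = {}"
      using cl by (intro Met_TC.metric_Baire_category_alt)
         (auto simp: complete_UNIV)
    then show False by (simp add: cov)
  qed
  then obtain n x r where r: "r > 0" "ball x r \<subseteq> A n"
    by (auto simp: mem_interior)
  \<comment> \<open>The bound is \<open>2 * real n\<close> because \<open>T u\<close> is the
    difference of \<open>T (x + u)\<close> and \<open>T x\<close>; the radius \<open>r/2\<close>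
    puts the closed ball of the criterion inside the open one.\<close>
  have "norm T \<le> (2 * real n) / (r/2)" if "T \<in> F" for T
  proof (rule blinfun_scaleR_norm_bound)
    fix u :: 'a assume "norm u \<le> r/2"
    then have "x + u \<in> A n" "x \<in> A n"
      using r by (auto simp: subset_iff dist_norm)
    then have "\<bar>T (x + u)\<bar> \<le> n" "\<bar>T x\<bar> \<le> n" using that by (auto simp: A_def)
    then show "\<bar>T u\<bar> \<le> 2 * real n" by (simp add: blinfun.add_right)
  qed (use r in simp)
  then show ?thesis by blast
qed

section \<open>Rosenthal's dichotomy\<close>

text \<open>Diagonal argument: choose decreasing sets \<open>L n\<close> and increasing members
  \<open>k n\<close>. The set of all \<open>k n\<close> lies in every \<open>L n\<close> up to
  finitely many elements, which is why \<open>P\<close> must pass to almost subsets.\<close>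

lemma infinite_subset_fusion:
  fixes P :: "nat \<Rightarrow> nat set \<Rightarrow> bool"
  assumes M: "infinite M"
    and ex: "\<And>n L. infinite L \<Longrightarrow> L \<subseteq> M \<Longrightarrow> \<exists>L'\<subseteq>L. infinite L' \<and> P n L'"
    and her: "\<And>n L L'. P n L \<Longrightarrow> infinite L' \<Longrightarrow> finite (L' - L) \<Longrightarrow> P n L'"
  obtains L where "L \<subseteq> M" "infinite L" "\<And>n. P n L"
proof -
  have "\<exists>f. \<forall>n. (case f n of (k, L) \<Rightarrow> infinite L \<and> L \<subseteq> M \<and> k \<in> L \<and> P n L) \<and>
     (case f n of (k, L) \<Rightarrow> \<lambda>(k', L'). L' \<subseteq> L \<and> k < k') (f (Suc n))"
  proof (rule dependent_nat_choice)
    obtain L where "L \<subseteq> M" "infinite L" "P 0 L" using ex[OF M] by blast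
    moreover then obtain k where "k \<in> L" using infinite_imp_nonempty by blast
    ultimately show "\<exists>x. case x of (k, L) \<Rightarrow> infinite L \<and> L \<subseteq> M \<and> k \<in> L \<and> P 0 L"
      by (intro exI[of _ "(k, L)"]) auto
  next
    fix x n assume x: "case x of (k, L) \<Rightarrow> infinite L \<and> L \<subseteq> M \<and> k \<in> L \<and> P n L"
    obtain k L where [simp]: "x = (k, L)" by fastforce
    obtain L' where L': "L' \<subseteq> L" "infinite L'" "P (Suc n) L'" using ex[of L "Suc n"] x by auto
    then obtain k' where "k' \<in> L'" "k < k'" by (meson infinite_nat_iff_unbounded)
    then show "\<exists>y. (case y of (k, L) \<Rightarrow> infinite L \<and> L \<subseteq> M \<and> k \<in> L \<and> P (Suc n) L) \<and>
        (case x of (k, L) \<Rightarrow> \<lambda>(k', L'). L' \<subseteq> L \<and> k < k') y"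
      using L' x by (intro exI[of _ "(k', L')"]) auto
  qed
  then obtain f where f: "\<forall>n. (case f n of (k, L) \<Rightarrow> infinite L \<and> L \<subseteq> M \<and> k \<in> L \<and> P n L) \<and>
     (case f n of (k, L) \<Rightarrow> \<lambda>(k', L'). L' \<subseteq> L \<and> k < k') (f (Suc n))"
    by (rule exE)
  define k where "k = (\<lambda>n. fst (f n))"
  define L where "L = (\<lambda>n. snd (f n))"
  have f1: "infinite (L n)" "L n \<subseteq> M" "k n \<in> L n" "P n (L n)" for n
    using f[rule_format, of n] by (auto simp: k_def L_def split: prod.splits)
  have f2: "L (Suc n) \<subseteq> L n" "k n < k (Suc n)" for n
    using f[rule_format, of n] by (auto simp: k_def L_def split: prod.splits)
  have "strict_mono k" using f2 by (simp add: strict_mono_Suc_iff)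
  then have inf: "infinite (range k)"
    using finite_imageD strict_mono_on_imp_inj_on by blast
  have anti: "L n \<subseteq> L m" if "m \<le> n" for m n
    using f2(1) that by (rule lift_Suc_antimono_le)
  have "P n (range k)" for n
  proof (rule her[OF f1(4) inf])
    have "range k - L n \<subseteq> k ` {..<n}"
    proof
      fix x assume "x \<in> range k - L n"
      then obtain m where "x = k m" "k m \<notin> L n" by blast
      moreover then have "m < n" using f1(3)[of m] anti[of n m] by (meson not_less subsetD)
      ultimately show "x \<in> k ` {..<n}" by blast
    qed
    then show "finite (range k - L n)" by (rule finite_subset) simp
  qed
  moreover have "range k \<subseteq> M" using f1 by blast
  ultimately show thesis using inf that by blast
qed

text \<open>In the application \<open>A l\<close> and \<open>B l\<close> consist of the points where
  the l-th function is at least b, respectively at most a, with a < b. The formula then says that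
  along \<open>L\<close> no point of \<open>K\<close> oscillates infinitely often across the
  gap.\<close>

definition converges_on :: "(nat \<Rightarrow> 's set) \<Rightarrow> (nat \<Rightarrow> 's set) \<Rightarrow> 's set \<Rightarrow> nat set \<Rightarrow> bool" where
  "converges_on A B K L \<longleftrightarrow> (\<forall>s\<in>K. finite {l\<in>L. s \<in> A l} \<or> finite {l\<in>L. s \<in> B l})"

text \<open>Hereditary failure of convergence. For infinite \<open>M\<close> it forces
  \<open>K\<close> to be nonempty, and this is how points realising prescribed patterns are
  found.\<close>

definition nowhere_convergent :: "(nat \<Rightarrow> 's set) \<Rightarrow> (nat \<Rightarrow> 's set) \<Rightarrow> 's set \<Rightarrow> nat set \<Rightarrow> bool" where
  "nowhere_convergent A B K M \<longleftrightarrow> (\<forall>L\<subseteq>M. infinite L \<longrightarrow> \<not> converges_on A B K L)"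

lemma nowhere_convergent_subset:
  "nowhere_convergent A B K M \<Longrightarrow> M' \<subseteq> M \<Longrightarrow> nowhere_convergent A B K M'"
  by (auto simp: nowhere_convergent_def)

lemma converges_on_almost_subset:
  assumes "converges_on A B K L" "finite (L' - L)"
  shows "converges_on A B K L'"
  unfolding converges_on_def
proof
  fix s assume "s \<in> K"
  have "{l\<in>L'. s \<in> C l} \<subseteq> {l\<in>L. s \<in> C l} \<union> (L' - L)" for C :: "nat \<Rightarrow> 'a set" by auto
  with assms \<open>s \<in> K\<close> show "finite {l\<in>L'. s \<in> A l} \<or> finite {l\<in>L'. s \<in> B l}"
    unfolding converges_on_def by (meson finite_UnI finite_subset)
qed

text \<open>If every \<open>n\<close> failed, fusion would give one \<open>L\<close> on which, for each \<open>n \<in> L\<close>, the sequence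
  converges on one of the finitely many pieces belonging to \<open>n\<close>. By the pigeonhole principle the
  same \<open>K\<close> and the same letter, say \<open>A\<close>, occur for infinitely many \<open>n\<close>; but some \<open>s \<in> K\<close> lies in
  infinitely many of these \<open>A n\<close> and \<open>B n\<close>.\<close>

lemma nowhere_convergent_split:
  assumes fin: "finite \<K>" and M: "infinite M"
    and nc: "\<And>K. K \<in> \<K> \<Longrightarrow> nowhere_convergent A B K M"
  shows "\<exists>n\<in>M. \<exists>M'\<subseteq>M. infinite M' \<and>
    (\<forall>K\<in>\<K>. nowhere_convergent A B (K \<inter> A n) M' \<and> nowhere_convergent A B (K \<inter> B n) M')"
proof (rule ccontr)
  assume neg: "\<not> ?thesis"
  define C where "C c = (if c then A else B)" for c
  define P where "P n L \<longleftrightarrow> (n \<in> M \<longrightarrow> (\<exists>K\<in>\<K>. \<exists>c. converges_on A B (K \<inter> C c n) L))" for n L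
  have ex: "\<exists>L'\<subseteq>L. infinite L' \<and> P n L'" if L: "infinite L" "L \<subseteq> M" for n L
  proof (cases "n \<in> M")
    case True
    with neg L obtain K where K: "K \<in> \<K>"
      "\<not> nowhere_convergent A B (K \<inter> A n) L \<or> \<not> nowhere_convergent A B (K \<inter> B n) L" by blast
    then obtain c where "\<not> nowhere_convergent A B (K \<inter> C c n) L"
      by (metis C_def)
    then obtain L' where "L' \<subseteq> L" "infinite L'" "converges_on A B (K \<inter> C c n) L'"
      by (auto simp: nowhere_convergent_def)
    with K show ?thesis by (auto simp: P_def)
  qed (use L in \<open>auto simp: P_def\<close>)
  have her: "P n L'" if "P n L" "infinite L'" "finite (L' - L)" for n L L'
    using that converges_on_almost_subset unfolding P_def by blast
  obtain L where L: "L \<subseteq> M" "infinite L" "\<And>n. P n L"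
    by (rule infinite_subset_fusion[of M P]) (use M ex her in \<open>blast+\<close>)
  then have "\<forall>n\<in>L. \<exists>p\<in>\<K> \<times> UNIV. converges_on A B (fst p \<inter> C (snd p) n) L"
    by (fastforce simp: P_def)
  then obtain p where p: "\<And>n. n \<in> L \<Longrightarrow> p n \<in> \<K> \<times> UNIV"
    "\<And>n. n \<in> L \<Longrightarrow> converges_on A B (fst (p n) \<inter> C (snd (p n)) n) L"
    by metis
  have "finite (\<K> \<times> (UNIV :: bool set))" using fin by simp
  then have "finite (p ` L)" using p(1) by (meson finite_subset image_subsetI)
  then obtain n0 where n0: "n0 \<in> L" "infinite {n\<in>L. p n = p n0}"
    using pigeonhole_infinite[OF L(2)] by blast
  obtain K c where Kc: "p n0 = (K, c)" "K \<in> \<K>" using p(1)[OF n0(1)] by (cases "p n0") auto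
  let ?L = "{n\<in>L. p n = p n0}"
  have "?L \<subseteq> M" using L(1) by auto
  then have "\<not> converges_on A B K ?L"
    using nc[OF Kc(2)] n0(2) by (simp add: nowhere_convergent_def)
  then obtain s where s: "s \<in> K" "infinite {l\<in>?L. s \<in> A l}" "infinite {l\<in>?L. s \<in> B l}"
    by (auto simp: converges_on_def)
  then have "infinite {l\<in>?L. s \<in> C c l}" by (simp add: C_def)
  then have "{l\<in>?L. s \<in> C c l} \<noteq> {}" by (rule infinite_imp_nonempty)
  then obtain n where n: "n \<in> L" "p n = (K, c)" "s \<in> C c n"
    using Kc by auto
  then have "finite {l\<in>L. s \<in> A l} \<or> finite {l\<in>L. s \<in> B l}"
    using p(2)[OF n(1)] s(1) by (auto simp: converges_on_def)
  moreover have "{l\<in>?L. s \<in> A l} \<subseteq> {l\<in>L. s \<in> A l}" "{l\<in>?L. s \<in> B l} \<subseteq> {l\<in>L. s \<in> B l}" by auto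
  ultimately show False using s finite_subset by blast
qed

text \<open>Splitting is iterated: at each stage all intersections formed so far are nowhere
  convergent on one common infinite set of indices, hence nonempty.\<close>

lemma independent_subsequence:
  assumes M: "infinite M" and nc: "nowhere_convergent A B S M"
  obtains n :: "nat \<Rightarrow> nat" where "strict_mono n"
    "\<And>N \<sigma>. \<exists>s\<in>S. \<forall>i<N. s \<in> (if \<sigma> i then A (n i) else B (n i))"
proof -
  define ok where "ok = (\<lambda>(k::nat, \<K>, M). finite \<K> \<and> infinite M \<and> (\<forall>K\<in>\<K>. nowhere_convergent A B K M))"
  define nxt where "nxt = (\<lambda>(k::nat, \<K>, M::nat set) (k'::nat, \<K>', M'::nat set).
     k < k' \<and> \<K>' = (\<lambda>K. K \<inter> A k') ` \<K> \<union> (\<lambda>K. K \<inter> B k') ` \<K>)"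
  have step: "\<exists>y. ok y \<and> nxt x y" if x: "ok x" for x
  proof -
    obtain k \<K> M where [simp]: "x = (k, \<K>, M)" by (cases x)
    have inf: "infinite (M \<inter> {k<..})"
      using x by (simp add: ok_def infinite_nat_iff_unbounded)
         (metis greaterThan_iff max.strict_boundedE max_less_iff_conj)
    have "nowhere_convergent A B K (M \<inter> {k<..})" if "K \<in> \<K>" for K
      using x that by (auto simp: ok_def intro: nowhere_convergent_subset)
    then obtain n M' where "n \<in> M \<inter> {k<..}" "M' \<subseteq> M \<inter> {k<..}" "infinite M'"
      "\<forall>K\<in>\<K>. nowhere_convergent A B (K \<inter> A n) M' \<and> nowhere_convergent A B (K \<inter> B n) M'"
      using nowhere_convergent_split[of \<K> "M \<inter> {k<..}" A B] inf x by (auto simp: ok_def)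
    then show ?thesis
      using x unfolding ok_def nxt_def
      by (intro exI[of _ "(n, (\<lambda>K. K \<inter> A n) ` \<K> \<union> (\<lambda>K. K \<inter> B n) ` \<K>, M')"]) auto
  qed
  have "\<exists>f. \<forall>i::nat. (ok (f i) \<and> (i = 0 \<longrightarrow> f i = (0, {S}, M))) \<and> nxt (f i) (f (Suc i))"
  proof (rule dependent_nat_choice)
    show "\<exists>x. ok x \<and> ((0::nat) = 0 \<longrightarrow> x = (0, {S}, M))" using M nc by (auto simp: ok_def)
  qed (use step in auto)
  then obtain f where f: "\<And>i. ok (f i)" "f 0 = (0, {S}, M)" "\<And>i. nxt (f i) (f (Suc i))" by blast
  define k where "k i = fst (f i)" for i
  define \<K> where "\<K> i = fst (snd (f i))" for i
  have kK: "k i < k (Suc i)"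
    "\<K> (Suc i) = (\<lambda>K. K \<inter> A (k (Suc i))) ` \<K> i \<union> (\<lambda>K. K \<inter> B (k (Suc i))) ` \<K> i" for i
    using f(3)[of i] by (auto simp: nxt_def k_def \<K>_def split: prod.splits)
  have ne: "K \<noteq> {}" if "K \<in> \<K> i" for K i
  proof
    assume [simp]: "K = {}"
    obtain k' \<K>' M' where "f i = (k', \<K>', M')" by (cases "f i")
    with f(1)[of i] that have "infinite M'" "nowhere_convergent A B {} M'"
      by (auto simp: ok_def \<K>_def)
    then show False unfolding nowhere_convergent_def converges_on_def by blast
  qed
  have mem: "{s\<in>S. \<forall>i<N. s \<in> (if \<sigma> i then A (k (Suc i)) else B (k (Suc i)))} \<in> \<K> N" for N \<sigma>
  proof (induction N)
    case 0
    then show ?case using f(2) by (simp add: \<K>_def)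
  next
    case (Suc N)
    have "{s\<in>S. \<forall>i<Suc N. s \<in> (if \<sigma> i then A (k (Suc i)) else B (k (Suc i)))} =
      {s\<in>S. \<forall>i<N. s \<in> (if \<sigma> i then A (k (Suc i)) else B (k (Suc i)))} \<inter>
        (if \<sigma> N then A (k (Suc N)) else B (k (Suc N)))"
      by (auto simp: less_Suc_eq)
    with Suc show ?case by (auto simp: kK(2))
  qed
  show thesis
  \<comment> \<open>The starting state carries the dummy index 0, so the first chosen index is
    \<open>k (Suc 0)\<close>.\<close>
  proof (rule that[of "\<lambda>i. k (Suc i)"])
    show "strict_mono (\<lambda>i. k (Suc i))" using kK by (simp add: strict_mono_Suc_iff)
    show "\<exists>s\<in>S. \<forall>i<N. s \<in> (if \<sigma> i then A (k (Suc i)) else B (k (Suc i)))" for N \<sigma>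
      using ne[OF mem[of N \<sigma>]] by blast
  qed
qed

lemma pointwise_Cauchy_or_independent:
  fixes \<phi> :: "nat \<Rightarrow> 's \<Rightarrow> real"
  assumes bd: "\<And>s. s \<in> S \<Longrightarrow> bounded (range (\<lambda>n. \<phi> n s))"
    and div: "\<And>r :: nat \<Rightarrow> nat. strict_mono r \<Longrightarrow> \<exists>s\<in>S. \<not> convergent (\<lambda>i. \<phi> (r i) s)"
  obtains a b and n :: "nat \<Rightarrow> nat" where "a < b" "strict_mono n"
    "\<And>N \<sigma>. \<exists>s\<in>S. \<forall>i<N. if \<sigma> i then b \<le> \<phi> (n i) s else \<phi> (n i) s \<le> a"
proof -
  define A where "A b n = {s. b \<le> \<phi> n s}" for b :: real and n
  define B where "B a n = {s. \<phi> n s \<le> a}" for a :: real and n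
  \<comment> \<open>Fusion handles countably many requirements, so the gaps are restricted to
    rational ones and enumerated.\<close>
  define pr :: "nat \<Rightarrow> real \<times> real" where
    "pr j = (case prod_decode j of (p, q) \<Rightarrow> (of_rat (from_nat p), of_rat (from_nat q)))" for j
  have ev: "\<exists>j. pr j = (of_rat p, of_rat q)" for p q
    by (intro exI[of _ "prod_encode (to_nat p, to_nat q)"]) (simp add: pr_def)
  have "\<exists>a b M. a < b \<and> infinite M \<and> nowhere_convergent (A b) (B a) S M"
  proof (rule ccontr)
    assume neg: "\<not> ?thesis"
    define P where "P j L \<longleftrightarrow> (fst (pr j) < snd (pr j) \<longrightarrow> converges_on (A (snd (pr j))) (B (fst (pr j))) S L)" for j L
    have ex: "\<exists>L'\<subseteq>L. infinite L' \<and> P j L'" if "infinite L" for j L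
      using neg that unfolding P_def nowhere_convergent_def by blast
    obtain L where L: "infinite L" "\<And>j. P j L"
    proof (rule infinite_subset_fusion[of UNIV P])
      show "P j L'" if "P j L" "infinite L'" "finite (L' - L)" for j L L'
        using that converges_on_almost_subset unfolding P_def by blast
    qed (use ex in auto)
    define r where "r = enumerate L"
    have r: "strict_mono r" "range r = L"
      using L by (auto simp: r_def strict_mono_enumerate range_enumerate)
    then obtain s where s: "s \<in> S" "\<not> convergent (\<lambda>i. \<phi> (r i) s)" using div by blast
    let ?f = "\<lambda>i. \<phi> (r i) s"
    have bf: "bounded (range ?f)" by (rule bounded_subset[OF bd[OF s(1)]]) auto
    then obtain l1 r1 where 1: "strict_mono r1" "(?f \<circ> r1) \<longlonglongrightarrow> l1"
      using bounded_imp_convergent_subsequence by blast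
    have "\<not> ?f \<longlonglongrightarrow> l1" using s convergent_def by blast
    then obtain e where e: "e > 0" "\<And>N. \<exists>n\<ge>N. e \<le> dist (?f n) l1"
      unfolding lim_sequentially by (meson not_less)
    then have "\<forall>N. \<exists>n>N. e \<le> dist (?f n) l1" by (metis Suc_le_lessD)
    then have "infinite {n. e \<le> dist (?f n) l1}"
      by (simp add: infinite_nat_iff_unbounded)
    then obtain r2 :: "nat \<Rightarrow> nat" where 2: "strict_mono r2" "\<And>n. e \<le> dist (?f (r2 n)) l1"
      using infinite_enumerate[of "{n. e \<le> dist (?f n) l1}"] by auto
    have "bounded (range (?f \<circ> r2))" by (rule bounded_subset[OF bf]) auto
    then obtain l2 r3 where 3: "strict_mono r3" "((?f \<circ> r2) \<circ> r3) \<longlonglongrightarrow> l2"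
      using bounded_imp_convergent_subsequence by blast
    have "l1 \<noteq> l2"
    proof
      assume "l1 = l2"
      then have "eventually (\<lambda>n. dist (((?f \<circ> r2) \<circ> r3) n) l1 < e) sequentially"
        using 3 e tendstoD by blast
      then obtain n where "dist (((?f \<circ> r2) \<circ> r3) n) l1 < e"
        by (meson eventually_sequentially order_refl)
      then show False using 2(2)[of "r3 n"] by simp
    qed
    \<comment> \<open>Distinct cluster points leave room for a rational gap between them, and both
      of its sides are met infinitely often in \<open>L\<close>, against \<open>P\<close> for that
      gap.\<close>
    have key: False if h: "l < l'" "strict_mono (p :: nat \<Rightarrow> nat)" "strict_mono (p' :: nat \<Rightarrow> nat)"
      "(\<lambda>i. ?f (p i)) \<longlonglongrightarrow> l" "(\<lambda>i. ?f (p' i)) \<longlonglongrightarrow> l'" for l l' p p'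
    proof -
      obtain c where c: "l < of_rat c" "of_rat c < l'" using of_rat_dense[OF h(1)] by blast
      obtain a where a: "l < of_rat a" "of_rat a < (of_rat c :: real)" using of_rat_dense[OF c(1)] by blast
      obtain j where j: "pr j = (of_rat a, of_rat c)" using ev by blast
      have inf: "infinite {l \<in> L. Q (\<phi> l s)}"
        if Q: "eventually (\<lambda>i. Q (?f (q i))) sequentially" "strict_mono (q :: nat \<Rightarrow> nat)" for q Q
      proof -
        obtain N where N: "\<And>i. i \<ge> N \<Longrightarrow> Q (?f (q i))"
          using Q by (auto simp: eventually_sequentially)
        have "strict_mono (\<lambda>i. r (q i))" using r Q by (simp add: strict_mono_def)
        then have "infinite ((\<lambda>i. r (q i)) ` {N..})"
          by (metis finite_imageD infinite_Ici strict_mono_on_imp_inj_on inj_on_subset subset_UNIV)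
        moreover have "(\<lambda>i. r (q i)) ` {N..} \<subseteq> {l \<in> L. Q (\<phi> l s)}" using N r by auto
        ultimately show ?thesis using finite_subset by blast
      qed
      have "eventually (\<lambda>i. of_rat c \<le> ?f (p' i)) sequentially"
        using order_tendstoD(1)[OF h(5) c(2)] by (auto elim: eventually_mono)
      then have "infinite {l \<in> L. s \<in> A (of_rat c) l}"
        using inf[of "\<lambda>t. of_rat c \<le> t"] h(3) by (simp add: A_def)
      moreover have "eventually (\<lambda>i. ?f (p i) \<le> of_rat a) sequentially"
        using order_tendstoD(2)[OF h(4) a(1)] by (auto elim: eventually_mono)
      then have "infinite {l \<in> L. s \<in> B (of_rat a) l}"
        using inf[of "\<lambda>t. t \<le> of_rat a"] h(2) by (simp add: B_def)
      ultimately show False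
        using L(2)[of j] a(2) s(1) by (auto simp: P_def j converges_on_def)
    qed
    have 4: "strict_mono (\<lambda>i. r2 (r3 i))" using 2(1) 3(1) by (simp add: strict_mono_def)
    from \<open>l1 \<noteq> l2\<close> show False
      using key[of l1 l2 r1 "\<lambda>i. r2 (r3 i)"] key[of l2 l1 "\<lambda>i. r2 (r3 i)" r1] 1 3(2) 4
      using less_linear[of l1 l2] by (auto simp: o_def)
  qed
  then obtain a b M where abM: "a < b" "infinite M" "nowhere_convergent (A b) (B a) S M" by blast
  show thesis
  proof (rule independent_subsequence[OF abM(2,3)])
    fix n :: "nat \<Rightarrow> nat"
    assume n: "strict_mono n"
      "\<And>N \<sigma>. \<exists>s\<in>S. \<forall>i<N. s \<in> (if \<sigma> i then A b (n i) else B a (n i))"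
    show thesis
    proof (rule that[OF abM(1) n(1)])
      fix N :: nat and \<sigma> :: "nat \<Rightarrow> bool"
      obtain s where s: "s \<in> S" "\<And>i. i < N \<Longrightarrow> s \<in> (if \<sigma> i then A b (n i) else B a (n i))"
        using n(2)[of N \<sigma>] by blast
      have "if \<sigma> i then b \<le> \<phi> (n i) s else \<phi> (n i) s \<le> a" if "i < N" for i
        using s(2)[OF that] by (simp add: A_def B_def split: if_splits)
      with s(1) show "\<exists>s\<in>S. \<forall>i<N. if \<sigma> i then b \<le> \<phi> (n i) s else \<phi> (n i) s \<le> a" by blast
    qed
  qed
qed

section \<open>Finitely additive means\<close>

text \<open>A finitely additive probability, given through its integral. The functional is total,
  but the axioms concern functions bounded on \<open>S\<close>; positivity looks at values on
  \<open>S\<close> alone, so the mean is carried by \<open>S\<close>.\<close>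

locale finitely_additive_mean =
  fixes S :: "'s set" and m :: "('s \<Rightarrow> real) \<Rightarrow> real"
  assumes one: "m (\<lambda>_. 1) = 1"
    and add: "bounded (\<phi> ` S) \<Longrightarrow> bounded (\<psi> ` S) \<Longrightarrow> m (\<lambda>s. \<phi> s + \<psi> s) = m \<phi> + m \<psi>"
    and scale: "bounded (\<phi> ` S) \<Longrightarrow> m (\<lambda>s. c * \<phi> s) = c * m \<phi>"
    and nonneg: "bounded (\<phi> ` S) \<Longrightarrow> (\<And>s. s \<in> S \<Longrightarrow> 0 \<le> \<phi> s) \<Longrightarrow> 0 \<le> m \<phi>"
begin

lemma diff:
  assumes "bounded (\<phi> ` S)" "bounded (\<psi> ` S)"
  shows "m (\<lambda>s. \<phi> s - \<psi> s) = m \<phi> - m \<psi>"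
proof -
  have "bounded ((\<lambda>s. (-1) * \<psi> s) ` S)"
    using assms(2) by (simp add: bounded_iff)
  from add[OF assms(1) this] scale[OF assms(2), of "-1"] show ?thesis by simp
qed

lemma mono:
  assumes "bounded (\<phi> ` S)" "bounded (\<psi> ` S)" "\<And>s. s \<in> S \<Longrightarrow> \<phi> s \<le> \<psi> s"
  shows "m \<phi> \<le> m \<psi>"
proof -
  have "0 \<le> m (\<lambda>s. \<psi> s - \<phi> s)"
    using assms by (intro nonneg) (auto intro: bounded_minus_comp)
  then show ?thesis using assms by (simp add: diff)
qed

lemma const: "m (\<lambda>_. c) = c"
proof -
  have "bounded ((\<lambda>_. 1 :: real) ` S)" by (auto simp: bounded_iff)
  from scale[OF this, of c] show ?thesis by (simp add: one)
qed

lemma abs_le: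
  assumes "bounded (\<phi> ` S)"
  shows "\<bar>m \<phi>\<bar> \<le> m (\<lambda>s. \<bar>\<phi> s\<bar>)"
proof -
  have b: "bounded ((\<lambda>s. \<bar>\<phi> s\<bar>) ` S)" "bounded ((\<lambda>s. (-1) * \<phi> s) ` S)"
    using assms by (auto simp: bounded_iff)
  have "m \<phi> \<le> m (\<lambda>s. \<bar>\<phi> s\<bar>)" using assms b by (intro mono) auto
  moreover have "m (\<lambda>s. (-1) * \<phi> s) \<le> m (\<lambda>s. \<bar>\<phi> s\<bar>)" using b by (intro mono) auto
  ultimately show ?thesis using scale[OF assms, of "-1"] by simp
qed

lemma sum:
  assumes "finite K" "\<And>k. k \<in> K \<Longrightarrow> bounded (\<phi> k ` S)"
  shows "bounded ((\<lambda>s. \<Sum>k\<in>K. \<phi> k s) ` S) \<and> m (\<lambda>s. \<Sum>k\<in>K. \<phi> k s) = (\<Sum>k\<in>K. m (\<phi> k))"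
  using assms
proof (induction K rule: finite_induct)
  case empty
  then show ?case by (auto simp: bounded_iff const)
next
  case (insert k K)
  then show ?case by (auto simp: add intro: bounded_plus_comp)
qed

text \<open>The variance, that is, the mean of the square of \<open>\<phi> s - m \<phi>\<close>, is
  nonnegative.\<close>

lemma sq_le:
  assumes "bounded (\<phi> ` S)"
  shows "(m \<phi>)\<^sup>2 \<le> m (\<lambda>s. (\<phi> s)\<^sup>2)"
proof -
  obtain B where "\<And>s. s \<in> S \<Longrightarrow> \<bar>\<phi> s\<bar> \<le> B" using assms by (auto simp: bounded_iff)
  then have "\<And>s. s \<in> S \<Longrightarrow> \<bar>(\<phi> s)\<^sup>2\<bar> \<le> B\<^sup>2" by (metis abs_ge_zero abs_power2 power2_abs power_mono)
  then have b2: "bounded ((\<lambda>s. (\<phi> s)\<^sup>2) ` S)" by (auto simp: bounded_iff)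
  have b3: "bounded ((\<lambda>s. (2 * m \<phi>) * \<phi> s) ` S)" "bounded ((\<lambda>s. (m \<phi>)\<^sup>2) ` S)"
    using bounded_scaling[OF assms, of "2 * m \<phi>"] by (auto simp: bounded_iff image_image)
  have "0 \<le> m (\<lambda>s. ((\<phi> s)\<^sup>2 - (2 * m \<phi>) * \<phi> s) + (m \<phi>)\<^sup>2)"
  proof (rule nonneg)
    show "bounded ((\<lambda>s. ((\<phi> s)\<^sup>2 - (2 * m \<phi>) * \<phi> s) + (m \<phi>)\<^sup>2) ` S)"
      using b2 b3 by (intro bounded_plus_comp bounded_minus_comp)
    show "0 \<le> ((\<phi> s)\<^sup>2 - (2 * m \<phi>) * \<phi> s) + (m \<phi>)\<^sup>2" for s
      using zero_le_power2[of "\<phi> s - m \<phi>"] by (simp add: power2_eq_square algebra_simps)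
  qed
  also have "\<dots> = m (\<lambda>s. (\<phi> s)\<^sup>2) - 2 * m \<phi> * m \<phi> + (m \<phi>)\<^sup>2"
    using b2 b3 assms by (simp only: add diff scale const bounded_minus_comp)
  finally show ?thesis by (simp add: power2_eq_square)
qed

lemma bounded_mult:
  fixes \<phi> \<psi> :: "'s \<Rightarrow> real"
  assumes "bounded (\<phi> ` S)" "bounded (\<psi> ` S)"
  shows "bounded ((\<lambda>s. \<phi> s * \<psi> s) ` S)"
proof -
  obtain B C where "\<And>s. s \<in> S \<Longrightarrow> \<bar>\<phi> s\<bar> \<le> B" "\<And>s. s \<in> S \<Longrightarrow> \<bar>\<psi> s\<bar> \<le> C"
    using assms by (auto simp: bounded_iff)
  then have "\<bar>\<phi> s * \<psi> s\<bar> \<le> B * C" if "s \<in> S" for s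
    using that by (simp add: abs_mult mult_mono')
  then show ?thesis by (auto simp: bounded_iff)
qed

lemma bounded_const [simp]: "bounded ((\<lambda>_. c :: real) ` S)"
  by (auto simp: bounded_iff)

text \<open>Let \<psi> be the orthogonal projection of \<phi> onto the span of the
  \<open>r n\<close> with n in \<open>K\<close>. The products of \<psi> with \<phi> and with itself
  both have the sum of squares as mean, so the claim is that the square of \<phi> - \<psi> has
  nonnegative mean.\<close>

lemma Bessel:
  assumes r: "\<And>n s. \<bar>r n s\<bar> = 1" and orth: "\<And>n k. n \<noteq> k \<Longrightarrow> m (\<lambda>s. r n s * r k s) = 0"
    and \<phi>: "bounded (\<phi> ` S)" and K: "finite K"
  shows "(\<Sum>n\<in>K. (m (\<lambda>s. r n s * \<phi> s))\<^sup>2) \<le> m (\<lambda>s. (\<phi> s)\<^sup>2)"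
proof -
  define c where "c n = m (\<lambda>s. r n s * \<phi> s)" for n
  define \<psi> where "\<psi> s = (\<Sum>n\<in>K. c n * r n s)" for s
  have br: "bounded (r n ` S)" for n using r by (auto simp: bounded_iff intro!: exI[of _ 1])
  have brr: "bounded ((\<lambda>s. r n s * r k s) ` S)" for n k by (intro bounded_mult br)
  have b\<psi>: "bounded (\<psi> ` S)" unfolding \<psi>_def
    using K br by (intro sum[THEN conjunct1] bounded_mult) (auto simp: bounded_iff)
  have \<psi>\<phi>: "m (\<lambda>s. \<psi> s * \<phi> s) = (\<Sum>n\<in>K. (c n)\<^sup>2)"
  proof -
    have "m (\<lambda>s. \<psi> s * \<phi> s) = m (\<lambda>s. \<Sum>n\<in>K. c n * (r n s * \<phi> s))"
      by (simp add: \<psi>_def sum_distrib_right mult.assoc)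
    also have "\<dots> = (\<Sum>n\<in>K. m (\<lambda>s. c n * (r n s * \<phi> s)))"
      using K br \<phi> by (intro sum[THEN conjunct2] bounded_mult) (auto simp: bounded_iff)
    also have "\<dots> = (\<Sum>n\<in>K. (c n)\<^sup>2)"
      using br \<phi> by (simp add: scale bounded_mult power2_eq_square c_def)
    finally show ?thesis .
  qed
  have m\<psi>: "m (\<lambda>s. r n s * \<psi> s) = c n" if "n \<in> K" for n
  proof -
    have "m (\<lambda>s. r n s * \<psi> s) = m (\<lambda>s. \<Sum>k\<in>K. c k * (r n s * r k s))"
      by (simp add: \<psi>_def sum_distrib_left mult_ac)
    also have "\<dots> = (\<Sum>k\<in>K. m (\<lambda>s. c k * (r n s * r k s)))"
      using K br by (intro sum[THEN conjunct2] bounded_mult) (auto simp: bounded_iff)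
    also have "\<dots> = (\<Sum>k\<in>K. c k * m (\<lambda>s. r n s * r k s))"
      using brr by (simp add: scale)
    also have "\<dots> = (\<Sum>k\<in>K. if k = n then c n else 0)"
    proof (rule sum.cong[OF refl])
      fix k
      have "r n s * r n s = 1" for s using r[of n s] by (metis abs_mult_self_eq mult_1)
      then show "c k * m (\<lambda>s. r n s * r k s) = (if k = n then c n else 0)"
        using orth[of n k] by (auto simp: one)
    qed
    also have "\<dots> = c n" using that K by simp
    finally show ?thesis .
  qed
  have \<psi>\<psi>: "m (\<lambda>s. \<psi> s * \<psi> s) = (\<Sum>n\<in>K. (c n)\<^sup>2)"
  proof -
    have "m (\<lambda>s. \<psi> s * \<psi> s) = m (\<lambda>s. \<Sum>n\<in>K. c n * (r n s * \<psi> s))"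
      by (subst (1) \<psi>_def) (simp add: sum_distrib_right mult.assoc)
    also have "\<dots> = (\<Sum>n\<in>K. m (\<lambda>s. c n * (r n s * \<psi> s)))"
      using K br b\<psi> by (intro sum[THEN conjunct2] bounded_mult) (auto simp: bounded_iff)
    also have "\<dots> = (\<Sum>n\<in>K. (c n)\<^sup>2)"
      using br b\<psi> m\<psi> by (simp add: scale bounded_mult power2_eq_square)
    finally show ?thesis .
  qed
  have b2: "bounded ((\<lambda>s. 2 * (\<psi> s * \<phi> s)) ` S)"
    using b\<psi> \<phi> by (intro bounded_mult bounded_const)
  have "0 \<le> m (\<lambda>s. (\<phi> s * \<phi> s - 2 * (\<psi> s * \<phi> s)) + \<psi> s * \<psi> s)"
  proof (rule nonneg)
    show "bounded ((\<lambda>s. (\<phi> s * \<phi> s - 2 * (\<psi> s * \<phi> s)) + \<psi> s * \<psi> s) ` S)"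
      using b\<psi> \<phi> by (intro bounded_plus_comp bounded_minus_comp bounded_mult) auto
    show "0 \<le> (\<phi> s * \<phi> s - 2 * (\<psi> s * \<phi> s)) + \<psi> s * \<psi> s" for s
      using zero_le_power2[of "\<phi> s - \<psi> s"] by (simp add: power2_eq_square algebra_simps)
  qed
  also have "\<dots> = m (\<lambda>s. \<phi> s * \<phi> s) - 2 * m (\<lambda>s. \<psi> s * \<phi> s) + m (\<lambda>s. \<psi> s * \<psi> s)"
    using b\<psi> b2 \<phi> scale[OF bounded_mult[OF b\<psi> \<phi>], of 2] bounded_const
    by (simp add: add diff bounded_minus_comp bounded_mult)
  finally show ?thesis unfolding c_def[symmetric] by (simp add: \<psi>\<phi> \<psi>\<psi> power2_eq_square)
qed

section \<open>Sets of positive mean and their intersections\<close>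

abbreviation pr :: "'s set \<Rightarrow> real" where "pr E \<equiv> m (indicator E)"

lemma bounded_indicator [simp]: "bounded ((indicator E :: 's \<Rightarrow> real) ` S)"
  by (auto simp: bounded_iff intro!: exI[of _ 1] simp: indicator_def)

lemma pr_le_1: "pr E \<le> 1"
proof -
  have "pr E \<le> m (\<lambda>_. 1)" by (rule mono) (auto simp: bounded_iff indicator_def)
  then show ?thesis by (simp add: one)
qed

lemma pr_pos_nonempty:
  assumes "0 < pr E" shows "\<exists>s\<in>S. s \<in> E"
proof (rule ccontr)
  assume "\<not> ?thesis"
  then have "pr E \<le> m (\<lambda>_. 0)" by (intro mono) (auto simp: bounded_iff)
  with assms show False by (simp add: const)
qed

text \<open>Many pairwise almost disjoint sets of measure at least \<open>\<epsilon>\<close> would contradict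
  \<open>(m F)\<^sup>2 \<le> m (F\<^sup>2)\<close> for the sum \<open>F\<close> of their indicators.\<close>

lemma eventually_pr_Int_ge:
  fixes E :: "nat \<Rightarrow> 's set"
  assumes U: "ultra_on U" "U \<le> sequentially" and e: "0 < \<epsilon>"
    and ev: "eventually (\<lambda>n. \<epsilon> \<le> pr (E n)) U"
  shows "\<exists>\<delta>>0. eventually (\<lambda>k. eventually (\<lambda>l. \<delta> \<le> pr (E k \<inter> E l)) U) U"
proof (rule ccontr)
  assume neg: "\<not> ?thesis"
  \<comment> \<open>With this \<delta>, a family of N sets gives N * \<epsilon>^2 <= 1 + N *
    \<epsilon>^2 / 2, hence N * \<epsilon>^2 <= 2, which fails for the N chosen below.\<close>
  define \<delta> where "\<delta> = \<epsilon>\<^sup>2 / 2"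
  have "\<delta> > 0" using e by (simp add: \<delta>_def)
  then have "\<not> eventually (\<lambda>k. eventually (\<lambda>l. \<delta> \<le> pr (E k \<inter> E l)) U) U" using neg by blast
  then have "eventually (\<lambda>k. \<not> eventually (\<lambda>l. \<delta> \<le> pr (E k \<inter> E l)) U) U"
    by (simp only: ultra_onD[OF U(1)])
  then have "eventually (\<lambda>k. eventually (\<lambda>l. \<not> \<delta> \<le> pr (E k \<inter> E l)) U) U"
    by (simp only: ultra_onD[OF U(1)])
  then have ev2: "eventually (\<lambda>k. \<epsilon> \<le> pr (E k) \<and> eventually (\<lambda>l. pr (E k \<inter> E l) < \<delta>) U) U"
    using ev by (simp add: eventually_conj_iff not_le)
  have K: "\<exists>K. finite K \<and> card K = N \<and> (\<forall>k\<in>K. \<epsilon> \<le> pr (E k) \<and> eventually (\<lambda>l. pr (E k \<inter> E l) < \<delta>) U) \<and>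
     (\<forall>k\<in>K. \<forall>l\<in>K. k \<noteq> l \<longrightarrow> pr (E k \<inter> E l) < \<delta>)" for N
  proof (induction N)
    case (Suc N)
    then obtain K where K: "finite K" "card K = N"
      "\<And>k. k \<in> K \<Longrightarrow> \<epsilon> \<le> pr (E k) \<and> eventually (\<lambda>l. pr (E k \<inter> E l) < \<delta>) U"
      "\<And>k l. k \<in> K \<Longrightarrow> l \<in> K \<Longrightarrow> k \<noteq> l \<Longrightarrow> pr (E k \<inter> E l) < \<delta>" by blast
    have "eventually (\<lambda>l. \<forall>k\<in>K. pr (E k \<inter> E l) < \<delta>) U"
      using K by (intro eventually_ball_finite) auto
    \<comment> \<open>An index above the maximum is new, so the family really grows; this is where
      \<open>U \<le> sequentially\<close> enters.\<close>
    moreover have "eventually (\<lambda>l. l > Max (insert 0 K)) U"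
      using U(2) eventually_gt_at_top filter_leD by blast
    ultimately have "eventually (\<lambda>l. (\<forall>k\<in>K. pr (E k \<inter> E l) < \<delta>) \<and> l > Max (insert 0 K) \<and>
       \<epsilon> \<le> pr (E l) \<and> eventually (\<lambda>j. pr (E l \<inter> E j) < \<delta>) U) U"
      using ev2 by (simp add: eventually_conj_iff)
    then obtain l where l: "\<forall>k\<in>K. pr (E k \<inter> E l) < \<delta>" "l > Max (insert 0 K)"
       "\<epsilon> \<le> pr (E l)" "eventually (\<lambda>j. pr (E l \<inter> E j) < \<delta>) U"
      using U(1) eventually_happens' unfolding ultra_on_def by blast
    have "l \<notin> K" using l(2) K(1) by (metis Max_ge finite_insert insertCI leD)
    then show ?case using K l
      by (intro exI[of _ "insert l K"]) (auto simp: Int_commute)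
  qed (intro exI[of _ "{}"], simp)
  obtain N :: nat where N: "2 / \<epsilon>\<^sup>2 < real N" using reals_Archimedean2 by blast
  have "0 < 2 / \<epsilon>\<^sup>2" using e by simp
  with N have N0: "0 < N" by (simp only: of_nat_0_less_iff[symmetric, where 'a = real])
  obtain K where K: "finite K" "card K = N" "\<And>k. k \<in> K \<Longrightarrow> \<epsilon> \<le> pr (E k)"
      "\<And>k l. k \<in> K \<Longrightarrow> l \<in> K \<Longrightarrow> k \<noteq> l \<Longrightarrow> pr (E k \<inter> E l) < \<delta>" using K[of N] by blast
  define F where "F s = (\<Sum>k\<in>K. indicator (E k) s :: real)" for s
  have F: "bounded (F ` S)" "m F = (\<Sum>k\<in>K. pr (E k))"
    using sum[of K "\<lambda>k. indicator (E k)"] K(1) by (auto simp: F_def[abs_def])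
  have "(\<lambda>s. (F s)\<^sup>2) = (\<lambda>s. \<Sum>k\<in>K. \<Sum>l\<in>K. indicator (E k \<inter> E l) s)"
    by (simp add: F_def power2_eq_square sum_product indicator_inter_arith)
  moreover have "m (\<lambda>s. \<Sum>k\<in>K. \<Sum>l\<in>K. indicator (E k \<inter> E l) s) = (\<Sum>k\<in>K. \<Sum>l\<in>K. pr (E k \<inter> E l))"
  proof -
    have inner: "bounded ((\<lambda>s. \<Sum>l\<in>K. indicator (E k \<inter> E l) s :: real) ` S) \<and>
       m (\<lambda>s. \<Sum>l\<in>K. indicator (E k \<inter> E l) s) = (\<Sum>l\<in>K. pr (E k \<inter> E l))" for k
      using K(1) by (intro sum) auto
    then show ?thesis using sum[of K "\<lambda>k s. \<Sum>l\<in>K. indicator (E k \<inter> E l) s"] K(1) by simp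
  qed
  ultimately have "m (\<lambda>s. (F s)\<^sup>2) = (\<Sum>k\<in>K. \<Sum>l\<in>K. pr (E k \<inter> E l))" by simp
  also have "\<dots> \<le> (\<Sum>k\<in>K. \<Sum>l\<in>K. (if k = l then 1 else 0) + \<delta>)"
    using K(4) pr_le_1 \<open>\<delta> > 0\<close> by (intro sum_mono) (fastforce intro: add_increasing2 less_imp_le)
  also have "\<dots> = N + N * N * \<delta>"
    using K(1,2) by (simp add: sum.distrib algebra_simps)
  finally have up: "m (\<lambda>s. (F s)\<^sup>2) \<le> N + N * N * \<delta>" .
  have "N * \<epsilon> \<le> m F" unfolding F(2) using sum_mono[of K "\<lambda>_. \<epsilon>" "\<lambda>k. pr (E k)"] K by simp
  then have "(N * \<epsilon>)\<^sup>2 \<le> (m F)\<^sup>2" using e by (intro power_mono) auto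
  also have "\<dots> \<le> N + N * N * \<delta>" using sq_le[OF F(1)] up by linarith
  finally have "N * (N * \<epsilon>\<^sup>2) \<le> N * (1 + N * \<delta>)" by (simp add: power2_eq_square algebra_simps)
  then have "N * \<epsilon>\<^sup>2 \<le> 1 + N * \<delta>" using N0 by (simp add: mult_le_cancel_left)
  then have "N * \<epsilon>\<^sup>2 \<le> 2" by (simp add: \<delta>_def)
  with N e show False by (simp add: field_simps)
qed

text \<open>Indices and points are chosen in turn: the point \<open>s r\<close> lies in all sets
  chosen so far, and each new index satisfies \<open>Q\<close> at all earlier points. The invariant
  is that the current intersection \<open>A\<close> meets U-most of the \<open>E l\<close> in a set
  of mean bounded below.\<close>

lemma intersecting_subsequence:
  fixes E :: "nat \<Rightarrow> 's set" and Q :: "'s \<Rightarrow> nat \<Rightarrow> nat \<Rightarrow> bool"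
  assumes U: "ultra_on U" "U \<le> sequentially" and e: "0 < \<epsilon>"
    and ev: "eventually (\<lambda>n. \<epsilon> \<le> pr (E n)) U"
    and Q: "\<And>s j. s \<in> S \<Longrightarrow> eventually (Q s j) U"
  obtains k :: "nat \<Rightarrow> nat" and s :: "nat \<Rightarrow> 's" where
    "\<And>r. s r \<in> S" "\<And>r j. j \<le> r \<Longrightarrow> s r \<in> E (k j)" "\<And>r j. r < j \<Longrightarrow> Q (s r) j (k j)"
proof -
  define ok where "ok = (\<lambda>(k::nat, t::'s, A, T). finite T \<and> T \<subseteq> S \<and>
     (\<exists>\<delta>>0. eventually (\<lambda>l. \<delta> \<le> pr (A \<inter> E l)) U))"
  define nxt where "nxt n = (\<lambda>(k::nat, t::'s, A::'s set, T::'s set) (k', t', A', T').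
     A' = A \<inter> E k' \<and> T' = insert t' T \<and> t' \<in> A' \<and> (\<forall>u\<in>T. Q u n k'))" for n
  have step: "\<exists>y. ok y \<and> nxt n x y" if x: "ok x" for x n
  proof -
    obtain k t A T where [simp]: "x = (k, t, A, T)" by (cases x)
    obtain \<delta> where T: "finite T" "T \<subseteq> S" and d: "\<delta> > 0" "eventually (\<lambda>l. \<delta> \<le> pr (A \<inter> E l)) U"
      using x by (auto simp: ok_def)
    \<comment> \<open>Applied to the sets \<open>A \<inter> E l\<close> in place of
      \<open>E l\<close>, which carries a lower bound over to the next intersection.\<close>
    obtain \<eta> where eta: "\<eta> > 0"
      "eventually (\<lambda>k. eventually (\<lambda>l. \<eta> \<le> pr ((A \<inter> E k) \<inter> (A \<inter> E l))) U) U"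
      using eventually_pr_Int_ge[OF U d] by blast
    have "eventually (\<lambda>k. \<forall>u\<in>T. Q u n k) U"
      using T Q by (intro eventually_ball_finite) auto
    with d(2) eta(2) have "eventually (\<lambda>k. (\<forall>u\<in>T. Q u n k) \<and> \<delta> \<le> pr (A \<inter> E k) \<and>
       eventually (\<lambda>l. \<eta> \<le> pr ((A \<inter> E k) \<inter> (A \<inter> E l))) U) U"
      by (simp add: eventually_conj_iff)
    then obtain k' where k': "\<forall>u\<in>T. Q u n k'" "\<delta> \<le> pr (A \<inter> E k')"
       "eventually (\<lambda>l. \<eta> \<le> pr ((A \<inter> E k') \<inter> (A \<inter> E l))) U"
      using U(1) eventually_happens' unfolding ultra_on_def by blast
    have "(A \<inter> E k') \<inter> (A \<inter> E l) = (A \<inter> E k') \<inter> E l" for l by auto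
    with k'(3) have k3: "eventually (\<lambda>l. \<eta> \<le> pr ((A \<inter> E k') \<inter> E l)) U" by simp
    obtain t' where "t' \<in> S" "t' \<in> A \<inter> E k'" using pr_pos_nonempty[of "A \<inter> E k'"] d(1) k'(2) by auto
    with k' k3 T eta(1) show ?thesis
      unfolding ok_def nxt_def by (intro exI[of _ "(k', t', A \<inter> E k', insert t' T)"]) auto
  qed
  have "\<exists>f. \<forall>i::nat. (ok (f i)) \<and> nxt i (f i) (f (Suc i))"
  proof (rule dependent_nat_choice)
    \<comment> \<open>With \<open>A = UNIV\<close> the invariant is the hypothesis
      \<open>ev\<close>. Index and point of the start are placeholders, so \<open>k\<close> and
      \<open>s\<close> below are read off the state after each step.\<close>
    show "\<exists>x. ok x" using e ev unfolding ok_def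
      by (intro exI[of _ "(0, undefined, UNIV, {})"]) auto
  qed (use step in auto)
  then obtain f where f: "\<And>i. ok (f i)" "\<And>i. nxt i (f i) (f (Suc i))" by blast
  define k where "k j = fst (f (Suc j))" for j
  define s where "s j = fst (snd (f (Suc j)))" for j
  define A where "A j = fst (snd (snd (f j)))" for j
  define T where "T j = snd (snd (snd (f j)))" for j
  have 1: "T j \<subseteq> S" "A (Suc j) = A j \<inter> E (k j)" "T (Suc j) = insert (s j) (T j)" "s j \<in> A (Suc j)"
    "\<And>u. u \<in> T j \<Longrightarrow> Q u j (k j)" for j
    using f(1)[of j] f(2)[of j]
    by (auto simp: ok_def nxt_def k_def s_def A_def T_def split: prod.splits)
  have Am: "A (Suc r) \<subseteq> A (Suc j)" if "j \<le> r" for j r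
    using that by (induction rule: dec_induct) (auto simp: 1)
  have Tm: "T (Suc r) \<subseteq> T j" if "r < j" for j r
    using that by (induction rule: strict_inc_induct[of _ _ "\<lambda>r. T (Suc r) \<subseteq> T j"]) (auto simp: 1(3))
  show thesis
  proof (rule that)
    show "s r \<in> S" for r using 1(1)[of "Suc r"] 1(3)[of r] by auto
    show "s r \<in> E (k j)" if "j \<le> r" for r j using Am[OF that] 1(4)[of r] 1(2)[of j] by auto
    show "Q (s r) j (k j)" if "r < j" for r j using Tm[OF that] 1(3)[of r] 1(5)[of "s r" j] by auto
  qed
qed

end

section \<open>Weakly compact sets\<close>

lemma topspace_weak_topology [simp]: "topspace weak_topology = UNIV"
proof -
  have "(blinfun_apply (0 :: 'a \<Rightarrow>\<^sub>L real) -` UNIV) = UNIV" by simp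
  then show ?thesis
    unfolding weak_topology_def topology_generated_by_topspace by blast
qed

lemma continuous_map_weak_topology_blinfun:
  fixes f :: "'a::real_normed_vector \<Rightarrow>\<^sub>L real"
  shows "continuous_map weak_topology euclideanreal f"
proof -
  have "openin weak_topology {x. f x \<in> V}" if "open V" for V
    using that unfolding weak_topology_def
    by (intro topology_generated_by_Basis) (auto simp: vimage_def)
  then show ?thesis by (auto simp: continuous_map_def)
qed

text \<open>Otherwise every point of \<open>C\<close> has a neighbourhood, defined by one
  functional, that the sequence eventually avoids along \<open>U\<close>; finitely many of these
  neighbourhoods cover \<open>C\<close>.\<close>

lemma weakly_compact_ultra_limit:
  fixes C :: "'a::real_normed_vector set"
  assumes C: "compactin weak_topology C" and U: "ultra_on U" and ev: "eventually (\<lambda>n. c n \<in> C) U"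
  obtains e where "e \<in> C" "\<And>f :: 'a \<Rightarrow>\<^sub>L real. ((\<lambda>n. f (c n)) \<longlongrightarrow> f e) U"
proof -
  have "\<exists>e\<in>C. \<forall>f :: 'a \<Rightarrow>\<^sub>L real. ((\<lambda>n. f (c n)) \<longlongrightarrow> f e) U"
  proof (rule ccontr)
    assume "\<not> ?thesis"
    then have "\<forall>e\<in>C. \<exists>f :: 'a \<Rightarrow>\<^sub>L real. \<exists>V. open V \<and> f e \<in> V \<and> \<not> eventually (\<lambda>n. f (c n) \<in> V) U"
      unfolding tendsto_def by blast
    from bchoice[OF this] obtain f :: "'a \<Rightarrow> 'a \<Rightarrow>\<^sub>L real" where
      "\<forall>e\<in>C. \<exists>V. open V \<and> f e e \<in> V \<and> \<not> eventually (\<lambda>n. f e (c n) \<in> V) U" by (elim exE)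
    from bchoice[OF this] obtain V where
      "\<forall>e\<in>C. open (V e) \<and> f e e \<in> V e \<and> \<not> eventually (\<lambda>n. f e (c n) \<in> V e) U" by (elim exE)
    then have fV: "\<And>e. e \<in> C \<Longrightarrow> open (V e)" "\<And>e. e \<in> C \<Longrightarrow> blinfun_apply (f e) e \<in> V e"
      "\<And>e. e \<in> C \<Longrightarrow> \<not> eventually (\<lambda>n. blinfun_apply (f e) (c n) \<in> V e) U" by auto
    let ?W = "\<lambda>e. {x. blinfun_apply (f e) x \<in> V e}"
    have op: "openin weak_topology (?W e)" if "e \<in> C" for e
      using continuous_map_weak_topology_blinfun[of "f e"] fV(1)[OF that] by (auto simp: continuous_map_def)
    have "\<exists>\<F>. finite \<F> \<and> \<F> \<subseteq> ?W ` C \<and> C \<subseteq> \<Union>\<F>"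
      using C op fV(2) unfolding compactin_def by (elim conjE allE[of _ "?W ` C"] impE) auto
    then obtain \<F> where \<F>: "finite \<F>" "\<F> \<subseteq> ?W ` C" "C \<subseteq> \<Union>\<F>" by blast
    then obtain D where D: "finite D" "D \<subseteq> C" "C \<subseteq> (\<Union>e\<in>D. ?W e)"
      using finite_subset_image[OF \<F>(1,2)] by blast
    have "eventually (\<lambda>n. \<forall>e\<in>D. \<not> blinfun_apply (f e) (c n) \<in> V e) U"
      using D fV(3) by (intro eventually_ball_finite) (auto simp: ultra_onD[OF U, symmetric])
    with ev have "eventually (\<lambda>n. False) U"
      by eventually_elim (use D in auto)
    with U show False by (simp add: ultra_on_def trivial_limit_def)
  qed
  with that show thesis by blast
qed

text \<open>Evaluations at points of \<open>C\<close> are functionals on the dual, which is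
  complete, and they are pointwise bounded because each \<open>f\<close> maps \<open>C\<close> onto
  a compact set of reals.\<close>

lemma weakly_compact_bound:
  fixes C :: "'a::real_normed_vector set"
  assumes C: "compactin weak_topology C"
  obtains M where "M > 0" "\<And>x (f :: 'a \<Rightarrow>\<^sub>L real). x \<in> C \<Longrightarrow> \<bar>blinfun_apply f x\<bar> \<le> M * norm f"
proof -
  define ev :: "'a \<Rightarrow> ('a \<Rightarrow>\<^sub>L real) \<Rightarrow>\<^sub>L real" where "ev x = Blinfun (\<lambda>f. blinfun_apply f x)" for x
  have ev: "blinfun_apply (ev x) f = blinfun_apply f x" for x f
    unfolding ev_def by (subst bounded_linear_Blinfun_apply[OF blinfun.bounded_linear_left]) (rule refl)
  have "\<exists>c. \<forall>T\<in>ev ` C. \<bar>blinfun_apply T f\<bar> \<le> c" for f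
  proof -
    have "compact (f ` C)"
      using image_compactin[OF C continuous_map_weak_topology_blinfun[of f]] by simp
    then have "bounded (f ` C)" by (rule compact_imp_bounded)
    then show ?thesis by (auto simp: bounded_iff ev)
  qed
  then obtain c where c: "\<And>x. x \<in> C \<Longrightarrow> norm (ev x) \<le> c"
    using uniform_boundedness[of "ev ` C"] by auto
  show thesis
  proof (rule that[of "max c 1"])
    fix x and f :: "'a \<Rightarrow>\<^sub>L real" assume "x \<in> C"
    have "\<bar>blinfun_apply f x\<bar> \<le> norm (ev x) * norm f"
      using norm_blinfun[of "ev x" f] by (simp add: ev)
    also have "\<dots> \<le> max c 1 * norm f" using c[OF \<open>x \<in> C\<close>] by (intro mult_right_mono) auto
    finally show "\<bar>blinfun_apply f x\<bar> \<le> max c 1 * norm f" .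
  qed simp
qed

text \<open>Banach-Alaoglu along an ultrafilter: the pointwise limit is again linear and
  bounded.\<close>

lemma ultra_limit_functional:
  fixes s :: "'i \<Rightarrow> 'a::real_normed_vector \<Rightarrow>\<^sub>L real"
  assumes U: "ultra_on U" and s: "\<And>r. norm (s r) \<le> 1"
  obtains g :: "'a \<Rightarrow>\<^sub>L real" where "\<And>x. ((\<lambda>r. s r x) \<longlongrightarrow> g x) U"
proof -
  have bd: "\<bar>s r x\<bar> \<le> norm x" for r x
    using norm_blinfun[of "s r" x] mult_right_mono[OF s[of r] norm_ge_zero[of x]] by simp
  define g where "g x = Lim U (\<lambda>r. s r x)" for x
  have lim: "((\<lambda>r. s r x) \<longlongrightarrow> g x) U" "\<bar>g x\<bar> \<le> norm x" for x
    unfolding g_def using ultra_on_tendsto_bounded[OF U, of "\<lambda>r. s r x", OF bd] by auto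
  have nb: "U \<noteq> bot" using U by (simp add: ultra_on_def)
  have "bounded_linear g"
  proof (rule bounded_linear_intro)
    show "g (x + y) = g x + g y" for x y
      using tendsto_unique[OF nb lim(1)[of "x + y"]] tendsto_add[OF lim(1)[of x] lim(1)[of y]]
      by (simp add: blinfun.add_right)
    show "g (c *\<^sub>R x) = c *\<^sub>R g x" for c x
      using tendsto_unique[OF nb lim(1)[of "c *\<^sub>R x"]] tendsto_scaleR[OF tendsto_const lim(1)[of x], of c]
      by (simp add: blinfun.scaleR_right)
    show "norm (g x) \<le> norm x * 1" for x using lim(2) by simp
  qed
  with lim(1) that[of "Blinfun g"] show thesis by (simp add: bounded_linear_Blinfun_apply)
qed

text \<open>Tychonoff for the cube; each condition on a partial sum is closed because it involves
  finitely many coordinates.\<close>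

lemma compact_l1_ball: "compact {a :: nat \<Rightarrow> real. \<forall>N. (\<Sum>n<N. \<bar>a n\<bar>) \<le> 1}"
proof -
  have "compactin (product_topology (\<lambda>_. euclidean) UNIV) (PiE UNIV (\<lambda>_::nat. {-1..1::real}))"
    by (simp add: compactin_PiE)
  then have c: "compact (PiE UNIV (\<lambda>_::nat. {-1..1::real}))"
    by (simp add: euclidean_product_topology)
  have eq: "{a :: nat \<Rightarrow> real. \<forall>N. (\<Sum>n<N. \<bar>a n\<bar>) \<le> 1} = (\<Inter>N. {a. (\<Sum>n<N. \<bar>a n\<bar>) \<le> 1})"
    by auto
  have "closed {a :: nat \<Rightarrow> real. (\<Sum>n<N. \<bar>a n\<bar>) \<le> 1}" for N
    by (intro closed_Collect_le continuous_intros continuous_on_product_coordinates)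
  then have cl: "closed {a :: nat \<Rightarrow> real. \<forall>N. (\<Sum>n<N. \<bar>a n\<bar>) \<le> 1}"
    unfolding eq by blast
  have "\<bar>a i\<bar> \<le> 1" if "\<forall>N. (\<Sum>n<N. \<bar>a n\<bar>) \<le> 1" for a :: "nat \<Rightarrow> real" and i
  proof -
    have "0 \<le> (\<Sum>n<i. \<bar>a n\<bar>)" by (rule sum_nonneg) simp
    moreover have "(\<Sum>n<i. \<bar>a n\<bar>) + \<bar>a i\<bar> \<le> 1" using spec[OF that, of "Suc i"] by simp
    ultimately show ?thesis by linarith
  qed
  then have "{a :: nat \<Rightarrow> real. \<forall>N. (\<Sum>n<N. \<bar>a n\<bar>) \<le> 1} \<subseteq> PiE UNIV (\<lambda>_::nat. {-1..1::real})"
    by (fastforce simp: abs_le_iff)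
  then show ?thesis
    using compact_Int_closed[OF c cl] by (simp add: Int_absorb1)
qed

text \<open>The absolutely convex hull of a weakly null sequence is weakly compact, being the image of
  the pointwise compact unit ball of \<open>\<ell>\<^sub>1\<close>.\<close>

lemma weakly_null_sequence_in_weakly_compact:
  fixes y :: "nat \<Rightarrow> 'a::banach"
  assumes bd: "\<And>n. norm (y n) \<le> B" and null: "\<And>f :: 'a \<Rightarrow>\<^sub>L real. (\<lambda>n. f (y n)) \<longlonglongrightarrow> 0"
  obtains K where "compactin weak_topology K" "absolutely_convex K" "range y \<subseteq> K"
proof -
  define A where "A = {a :: nat \<Rightarrow> real. \<forall>N. (\<Sum>n<N. \<bar>a n\<bar>) \<le> 1}"
  define \<Phi> where "\<Phi> a = (\<Sum>n. a n *\<^sub>R y n)" for a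
  have sa: "summable (\<lambda>n. \<bar>a n\<bar>)" if "a \<in> A" for a
  proof (rule bounded_imp_summable)
    show "(\<Sum>k\<le>n. \<bar>a k\<bar>) \<le> 1" for n
      using that unfolding A_def by (metis (mono_tags) lessThan_Suc_atMost mem_Collect_eq)
  qed simp
  have sy: "summable (\<lambda>n. a n *\<^sub>R y n)" if "a \<in> A" for a
  proof (rule summable_comparison_test)
    show "summable (\<lambda>n. \<bar>a n\<bar> * B)" using sa[OF that] by (rule summable_mult2)
    show "\<exists>N. \<forall>n\<ge>N. norm (a n *\<^sub>R y n) \<le> \<bar>a n\<bar> * B" using bd by (auto intro!: mult_left_mono)
  qed
  have \<Phi>f: "f (\<Phi> a) = (\<Sum>n. a n * f (y n))" "summable (\<lambda>n. a n * f (y n))"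
    if "a \<in> A" for a and f :: "'a \<Rightarrow>\<^sub>L real"
    using bounded_linear.suminf[OF blinfun.bounded_linear_right sy[OF that], of f]
      bounded_linear.summable[OF blinfun.bounded_linear_right sy[OF that], of f]
    by (simp_all add: \<Phi>_def blinfun.scaleR_right)
  have cont: "continuous_on A (\<lambda>a. f (\<Phi> a))" for f :: "'a \<Rightarrow>\<^sub>L real"
  proof (rule uniform_limit_theorem)
    show "eventually (\<lambda>N. continuous_on A (\<lambda>a. \<Sum>n<N. a n * f (y n))) sequentially"
      by (intro always_eventually allI continuous_intros continuous_on_product_then_coordinatewise continuous_on_id)
    \<comment> \<open>Weak nullity is decisive here: the remainder of the series is bounded by the
      supremum of |f (y n)| over the tail, uniformly on the unit ball of l1.\<close>
    show "uniform_limit A (\<lambda>N a. \<Sum>n<N. a n * f (y n)) (\<lambda>a. f (\<Phi> a)) sequentially"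
    proof (rule uniform_limitI)
      fix e :: real assume "e > 0"
      then have "eventually (\<lambda>n. \<bar>f (y n)\<bar> < e / 2) sequentially"
        using tendstoD[OF null[of f], of "e/2"] by (simp add: dist_real_def)
      then obtain N where N: "\<And>n. n \<ge> N \<Longrightarrow> \<bar>f (y n)\<bar> < e / 2" by (auto simp: eventually_sequentially)
      have "dist (\<Sum>n<k. a n * f (y n)) (f (\<Phi> a)) < e" if "k \<ge> N" "a \<in> A" for k a
      proof -
        have eq: "f (\<Phi> a) - (\<Sum>n<k. a n * f (y n)) = (\<Sum>n. a (n + k) * f (y (n + k)))"
          using suminf_minus_initial_segment[OF \<Phi>f(2)[OF that(2)], of k f] \<Phi>f(1)[OF that(2), of f] by simp
        have sk: "summable (\<lambda>n. \<bar>a (n + k)\<bar>)" using sa[OF that(2)] by (rule summable_ignore_initial_segment)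
        have le: "\<bar>a (n + k) * f (y (n + k))\<bar> \<le> \<bar>a (n + k)\<bar> * (e/2)" for n
          unfolding abs_mult using N[of "n + k"] that(1) by (intro mult_left_mono) auto
        have "\<bar>f (\<Phi> a) - (\<Sum>n<k. a n * f (y n))\<bar> \<le> (\<Sum>n. \<bar>a (n + k)\<bar> * (e/2))"
          unfolding eq real_norm_def[symmetric]
          by (rule norm_suminf_le) (use le sk in \<open>auto intro: summable_mult2\<close>)
        also have "\<dots> = (\<Sum>n. \<bar>a (n + k)\<bar>) * (e/2)" using sk by (rule suminf_mult2[symmetric])
        also have "(\<Sum>n. \<bar>a (n + k)\<bar>) \<le> (\<Sum>n. \<bar>a n\<bar>)"
          using suminf_minus_initial_segment[OF sa[OF that(2)], of k] sum_nonneg[of "{..<k}" "\<lambda>n. \<bar>a n\<bar>"] by simp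
        also have "(\<Sum>n. \<bar>a n\<bar>) \<le> 1"
          using that(2) sa[OF that(2)] unfolding A_def by (intro suminf_le_const) auto
        finally show ?thesis using \<open>e > 0\<close> by (simp add: dist_real_def abs_minus_commute)
      qed
      then show "eventually (\<lambda>k. \<forall>a\<in>A. dist (\<Sum>n<k. a n * f (y n)) (f (\<Phi> a)) < e) sequentially"
        by (auto simp: eventually_sequentially)
    qed
  qed simp
  have "continuous_map (top_of_set A) weak_topology \<Phi>"
    unfolding weak_topology_def
  proof (rule continuous_on_generated_topo)
    show "\<Phi> ` topspace (top_of_set A) \<subseteq> \<Union> {blinfun_apply f -` U |(f :: 'a \<Rightarrow>\<^sub>L real) U. open U}"
      using topspace_weak_topology[where 'a = 'a]
      unfolding weak_topology_def topology_generated_by_topspace by simp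
  next
    fix W assume "W \<in> {blinfun_apply f -` U |(f :: 'a \<Rightarrow>\<^sub>L real) U. open U}"
    then obtain f :: "'a \<Rightarrow>\<^sub>L real" and U where W: "W = blinfun_apply f -` U" "open U" by blast
    have "openin (top_of_set A) (A \<inter> (\<lambda>a. f (\<Phi> a)) -` U)"
      using cont[of f] W(2) by (simp add: continuous_openin_preimage_gen)
    also have "A \<inter> (\<lambda>a. f (\<Phi> a)) -` U = \<Phi> -` W \<inter> topspace (top_of_set A)"
      by (auto simp: W)
    finally show "openin (top_of_set A) (\<Phi> -` W \<inter> topspace (top_of_set A))" .
  qed
  moreover have "compactin (top_of_set A) A"
    using compact_l1_ball by (simp add: compactin_subtopology A_def)
  ultimately have 1: "compactin weak_topology (\<Phi> ` A)" by (rule image_compactin[rotated])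
  \<comment> \<open>One inclusion serves both properties: \<open>u + v = 1\<close> gives convexity
    and \<open>v = 0\<close> circledness.\<close>
  have comb: "u *\<^sub>R \<Phi> a + v *\<^sub>R \<Phi> b \<in> \<Phi> ` A" if "a \<in> A" "b \<in> A" "\<bar>u\<bar> + \<bar>v\<bar> \<le> 1" for u v a b
  proof (rule image_eqI)
    have "(\<lambda>n. u *\<^sub>R (a n *\<^sub>R y n)) sums (u *\<^sub>R \<Phi> a)" "(\<lambda>n. v *\<^sub>R (b n *\<^sub>R y n)) sums (v *\<^sub>R \<Phi> b)"
      unfolding \<Phi>_def by (intro sums_scaleR_right summable_sums sy that)+
    then have "(\<lambda>n. (u * a n + v * b n) *\<^sub>R y n) sums (u *\<^sub>R \<Phi> a + v *\<^sub>R \<Phi> b)"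
      using sums_add by (fastforce simp: scaleR_left_distrib)
    then show "u *\<^sub>R \<Phi> a + v *\<^sub>R \<Phi> b = \<Phi> (\<lambda>n. u * a n + v * b n)"
      by (simp add: \<Phi>_def sums_iff)
    have "(\<Sum>n<N. \<bar>u * a n + v * b n\<bar>) \<le> 1" for N
    proof -
      have "(\<Sum>n<N. \<bar>u * a n + v * b n\<bar>) \<le> (\<Sum>n<N. \<bar>u\<bar> * \<bar>a n\<bar> + \<bar>v\<bar> * \<bar>b n\<bar>)"
        by (intro sum_mono) (metis abs_mult abs_triangle_ineq)
      also have "\<dots> = \<bar>u\<bar> * (\<Sum>n<N. \<bar>a n\<bar>) + \<bar>v\<bar> * (\<Sum>n<N. \<bar>b n\<bar>)"
        by (simp add: sum.distrib sum_distrib_left)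
      also have "\<dots> \<le> \<bar>u\<bar> * 1 + \<bar>v\<bar> * 1"
        using that by (intro add_mono mult_left_mono) (auto simp: A_def)
      finally show ?thesis using that by simp
    qed
    then show "(\<lambda>n. u * a n + v * b n) \<in> A" by (simp add: A_def)
  qed
  have 2: "absolutely_convex (\<Phi> ` A)"
    unfolding absolutely_convex_def circled_def convex_def
  proof (intro conjI ballI allI impI)
    fix x z and u v :: real
    assume "x \<in> \<Phi> ` A" "z \<in> \<Phi> ` A" "0 \<le> u" "0 \<le> v" "u + v = 1"
    then show "u *\<^sub>R x + v *\<^sub>R z \<in> \<Phi> ` A" using comb by auto
  next
    fix c :: real assume "\<bar>c\<bar> \<le> 1"
    then show "(\<lambda>x. c *\<^sub>R x) ` \<Phi> ` A \<subseteq> \<Phi> ` A" using comb[of _ _ c 0] by auto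
  qed
  have "y n \<in> \<Phi> ` A" for n
  proof (rule image_eqI)
    show "(\<lambda>k. if k = n then 1 else 0) \<in> A"
    proof -
      have "(\<Sum>k<N. \<bar>if k = n then 1 else 0 :: real\<bar>) = (\<Sum>k<N. if k = n then 1 else 0)" for N
        by (intro sum.cong) auto
      then show ?thesis by (simp add: A_def)
    qed
    have "(\<lambda>k. (if k = n then 1 else 0) *\<^sub>R y k) = (\<lambda>k. if k = n then y k else 0)" by auto
    then show "y n = \<Phi> (\<lambda>k. if k = n then 1 else 0)"
      using sums_If_finite[of "\<lambda>k. k = n" y] by (simp add: \<Phi>_def sums_iff)
  qed
  with 1 2 that show thesis by blast
qed

section \<open>Functionals that are uniformly null on weakly compact sets\<close>

text \<open>Functionals \<open>s r\<close> with \<open>\<bar>s r (d (k j))\<bar>\<close> large for \<open>j \<le> r\<close> but small for \<open>r < j\<close> contradict the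
  interchange of the two iterated limits, which holds on a weakly compact set.\<close>

lemma weakly_null_imp_mean_abs_null:
  fixes C :: "'a::real_normed_vector set" and S :: "('a \<Rightarrow>\<^sub>L real) set"
  assumes mean: "finitely_additive_mean S m" and S: "\<And>g. g \<in> S \<Longrightarrow> norm g \<le> 1"
    and C: "compactin weak_topology C" and U: "ultra_on U" "U \<le> sequentially"
    and c: "\<And>n. c n \<in> C" "c0 \<in> C"
    and lim: "\<And>f :: 'a \<Rightarrow>\<^sub>L real. ((\<lambda>n. f (c n)) \<longlongrightarrow> f c0) U"
    and \<epsilon>: "0 < \<epsilon>"
  shows "\<not> eventually (\<lambda>n. \<epsilon> \<le> m (\<lambda>g. \<bar>blinfun_apply g (c n - c0)\<bar>)) U"
proof
  assume ev: "eventually (\<lambda>n. \<epsilon> \<le> m (\<lambda>g. \<bar>blinfun_apply g (c n - c0)\<bar>)) U"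
  interpret finitely_additive_mean S m by (rule mean)
  define d where "d n = c n - c0" for n
  obtain M where M: "M > 0" "\<And>x (f :: 'a \<Rightarrow>\<^sub>L real). x \<in> C \<Longrightarrow> \<bar>blinfun_apply f x\<bar> \<le> M * norm f"
    using weakly_compact_bound[OF C] by blast
  have bd: "\<bar>blinfun_apply g (d n)\<bar> \<le> 2 * M" if "g \<in> S" for g n
  proof -
    have "M * norm g \<le> M" using S[OF that] M(1) by simp
    then show ?thesis
      using M(2)[OF c(1)[of n], of g] M(2)[OF c(2), of g] by (simp add: d_def blinfun.diff_right)
  qed
  define E where "E n = {g :: 'a \<Rightarrow>\<^sub>L real. \<epsilon> / 2 \<le> \<bar>g (d n)\<bar>}" for n
  \<comment> \<open>A Chebyshev estimate: the integrand is below \<epsilon> / 2 outside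
    \<open>E n\<close> and at most 2 * M on it. It turns a mean of at least \<epsilon> into
    \<open>pr (E n)\<close> at least \<epsilon> / (4 * M).\<close>
  have mE: "m (\<lambda>g. \<bar>blinfun_apply g (d n)\<bar>) \<le> \<epsilon> / 2 + 2 * M * pr (E n)" for n
  proof -
    have "m (\<lambda>g. \<bar>blinfun_apply g (d n)\<bar>) \<le> m (\<lambda>g. \<epsilon> / 2 + 2 * M * indicator (E n) g)"
    proof (rule mono)
      show "bounded ((\<lambda>g. \<bar>blinfun_apply g (d n)\<bar>) ` S)"
        using bd by (auto simp: bounded_iff)
      show "bounded ((\<lambda>g. \<epsilon> / 2 + 2 * M * indicator (E n) g) ` S)"
        by (intro bounded_plus_comp bounded_mult) simp_all
      show "\<bar>blinfun_apply g (d n)\<bar> \<le> \<epsilon> / 2 + 2 * M * indicator (E n) g" if "g \<in> S" for g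
        using bd[OF that, of n] \<epsilon> by (simp add: E_def indicator_def)
    qed
    also have "\<dots> = \<epsilon> / 2 + 2 * M * pr (E n)"
    proof -
      have "bounded ((\<lambda>g. 2 * M * indicator (E n) g :: real) ` S)" by (intro bounded_mult) simp_all
      then show ?thesis by (simp add: add const scale)
    qed
    finally show ?thesis .
  qed
  have evE: "eventually (\<lambda>n. \<epsilon> / (4 * M) \<le> pr (E n)) U"
    using ev
  proof eventually_elim
    fix n assume "\<epsilon> \<le> m (\<lambda>g. \<bar>blinfun_apply g (c n - c0)\<bar>)"
    then have "\<epsilon> / 2 \<le> 2 * M * pr (E n)" using mE[of n] by (simp add: d_def)
    then show "\<epsilon> / (4 * M) \<le> pr (E n)" using M(1) by (simp add: field_simps)
  qed
  have limd: "((\<lambda>n. blinfun_apply g (d n)) \<longlongrightarrow> 0) U" for g :: "'a \<Rightarrow>\<^sub>L real"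
    using tendsto_diff[OF lim[of g] tendsto_const[of "g c0"]] by (simp add: d_def blinfun.diff_right)
  have Q: "eventually (\<lambda>k. \<bar>blinfun_apply g (d k)\<bar> < 1 / (real j + 1)) U" for g :: "'a \<Rightarrow>\<^sub>L real" and j
    using tendstoD[OF limd[of g], of "1 / (real j + 1)"] by simp
  have "0 < \<epsilon> / (4 * M)" using \<epsilon> M(1) by simp
  then have "\<exists>(k :: nat \<Rightarrow> nat) s. (\<forall>r. s r \<in> S) \<and> (\<forall>r j. j \<le> r \<longrightarrow> s r \<in> E (k j)) \<and>
     (\<forall>r j. r < j \<longrightarrow> \<bar>blinfun_apply (s r) (d (k j))\<bar> < 1 / (real j + 1))"
    by (rule intersecting_subsequence[OF U _ evE, of "\<lambda>g j k. \<bar>blinfun_apply g (d k)\<bar> < 1 / (real j + 1)"])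
       (use Q in blast)+
  then obtain k :: "nat \<Rightarrow> nat" and s where ks: "\<And>r. s r \<in> S" "\<And>r j. j \<le> r \<Longrightarrow> s r \<in> E (k j)"
     "\<And>r j. r < j \<Longrightarrow> \<bar>blinfun_apply (s r) (d (k j))\<bar> < 1 / (real j + 1)"
    by blast
  obtain g :: "'a \<Rightarrow>\<^sub>L real" where g: "\<And>x. ((\<lambda>r. s r x) \<longlongrightarrow> g x) U"
    using ultra_limit_functional[OF U(1), of s] S ks(1) by blast
  obtain e where e: "e \<in> C" "\<And>f :: 'a \<Rightarrow>\<^sub>L real. ((\<lambda>j. f (c (k j))) \<longlongrightarrow> f e) U"
    using weakly_compact_ultra_limit[OF C U(1), of "\<lambda>j. c (k j)"] c(1) by auto
  have limk: "((\<lambda>j. blinfun_apply f (d (k j))) \<longlongrightarrow> f (e - c0)) U" for f :: "'a \<Rightarrow>\<^sub>L real"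
    using tendsto_diff[OF e(2)[of f] tendsto_const[of "f c0"]] by (simp add: d_def blinfun.diff_right)
  have nb: "U \<noteq> bot" using U by (simp add: ultra_on_def)
  have evseq: "eventually P U" if "eventually P sequentially" for P
    using that U(2) by (rule filter_leD[rotated])
  \<comment> \<open>First order of limits: for fixed r the tolerances 1 / (j + 1) tend to 0, so
    every \<open>s r\<close>, and with them \<open>g\<close>, vanishes at
    \<open>e - c0\<close>.\<close>
  have "\<bar>blinfun_apply (s r) (e - c0)\<bar> \<le> 0" for r
  proof (rule tendsto_le[OF nb _ tendsto_rabs[OF limk[of "s r"]]])
    have "(\<lambda>j. 1 / (real j + 1)) \<longlonglongrightarrow> 0" 
      using LIMSEQ_inverse_real_of_nat by (simp add: inverse_eq_divide add.commute)
    then show "((\<lambda>j. 1 / (real j + 1)) \<longlongrightarrow> 0) U" using U(2) by (rule tendsto_mono[rotated])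
    show "eventually (\<lambda>j. \<bar>blinfun_apply (s r) (d (k j))\<bar> \<le> 1 / (real j + 1)) U"
      by (rule evseq, rule eventually_mono[OF eventually_gt_at_top[of r]]) (use ks(3) in \<open>auto intro: less_imp_le\<close>)
  qed
  then have "g (e - c0) = 0"
    using tendsto_unique[OF nb g[of "e - c0"], of 0] by simp
  \<comment> \<open>Second order of limits: for fixed j the lower bound on \<open>E (k j)\<close>,
    valid for all r \<ge> j, passes to \<open>g\<close>; then j runs along \<open>U\<close>.\<close>
  moreover have "\<epsilon> / 2 \<le> \<bar>g (d (k j))\<bar>" for j
  proof (rule tendsto_le[OF nb tendsto_rabs[OF g[of "d (k j)"]] tendsto_const])
    show "eventually (\<lambda>r. \<epsilon> / 2 \<le> \<bar>blinfun_apply (s r) (d (k j))\<bar>) U"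
      by (rule evseq, rule eventually_mono[OF eventually_ge_at_top[of j]]) (use ks(2) in \<open>auto simp: E_def\<close>)
  qed
  then have "\<epsilon> / 2 \<le> \<bar>g (e - c0)\<bar>"
    by (intro tendsto_le[OF nb tendsto_rabs[OF limk[of g]] tendsto_const] always_eventually allI)
  ultimately show False using \<epsilon> by simp
qed

text \<open>Domination moves the question from the varying \<open>h n\<close> to one seminorm: where
  \<open>h n\<close> is large at \<open>c n\<close> but small at the weak limit \<open>c0\<close>,
  it is large at \<open>c n - c0\<close>, and so is the seminorm.\<close>

lemma mean_dominated_imp_uniformly_null:
  fixes C :: "'a::real_normed_vector set" and S :: "('a \<Rightarrow>\<^sub>L real) set" and h :: "nat \<Rightarrow> 'a \<Rightarrow>\<^sub>L real"
  assumes mean: "finitely_additive_mean S m" and S: "\<And>g. g \<in> S \<Longrightarrow> norm g \<le> 1"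
    and C: "compactin weak_topology C"
    and h: "\<And>x. (\<lambda>n. h n x) \<longlonglongrightarrow> 0" and dom: "\<And>n x. \<bar>h n x\<bar> \<le> m (\<lambda>g. \<bar>blinfun_apply g x\<bar>)"
    and \<epsilon>: "0 < \<epsilon>"
  shows "eventually (\<lambda>n. \<forall>x\<in>C. \<bar>h n x\<bar> \<le> \<epsilon>) sequentially"
proof (rule ccontr)
  assume "\<not> ?thesis"
  then have fr: "frequently (\<lambda>n. \<exists>x\<in>C. \<epsilon> < \<bar>h n x\<bar>) sequentially"
    by (simp add: not_eventually not_le)
  define I where "I = {n. \<exists>x\<in>C. \<epsilon> < \<bar>h n x\<bar>}"
  have "inf sequentially (principal I) \<noteq> bot"
    using fr by (simp add: trivial_limit_def eventually_inf_principal I_def frequently_def)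
  \<comment> \<open>Failure is merely frequent, so the ultrafilter is made to live on the bad
    indices.\<close>
  then obtain U where U: "U \<le> inf sequentially (principal I)" "ultra_on U"
    using ultrafilter_exists by blast
  then have Us: "U \<le> sequentially" and UI: "eventually (\<lambda>n. n \<in> I) U"
    by (auto simp: le_principal)
  have "\<exists>n. n \<in> I" using fr frequently_ex unfolding I_def by blast
  then obtain c1 where "c1 \<in> C" by (auto simp: I_def)
  \<comment> \<open>Outside \<open>I\<close> the default \<open>c1\<close> keeps every
    \<open>c n\<close> in \<open>C\<close>.\<close>
  define c where "c n = (if n \<in> I then SOME x. x \<in> C \<and> \<epsilon> < \<bar>h n x\<bar> else c1)" for n
  have cI: "c n \<in> C \<and> \<epsilon> < \<bar>h n (c n)\<bar>" if "n \<in> I" for n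
  proof -
    have "\<exists>x. x \<in> C \<and> \<epsilon> < \<bar>h n x\<bar>" using that by (auto simp: I_def)
    from someI_ex[OF this] show ?thesis using that by (simp add: c_def)
  qed
  have cC: "c n \<in> C" for n using cI \<open>c1 \<in> C\<close> by (cases "n \<in> I") (auto simp: c_def)
  obtain c0 where c0: "c0 \<in> C" "\<And>f :: 'a \<Rightarrow>\<^sub>L real. ((\<lambda>n. f (c n)) \<longlongrightarrow> f c0) U"
    using weakly_compact_ultra_limit[OF C U(2), of c] cC by auto
  have "eventually (\<lambda>n. \<bar>h n c0\<bar> < \<epsilon> / 2) U"
    using tendstoD[OF h[of c0], of "\<epsilon> / 2"] \<epsilon> Us by (auto intro: filter_leD)
  with UI have "eventually (\<lambda>n. \<epsilon> / 2 \<le> m (\<lambda>g. \<bar>blinfun_apply g (c n - c0)\<bar>)) U"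
  proof eventually_elim
    case (elim n)
    then show ?case using cI[of n] dom[of n "c n - c0"] abs_triangle_ineq2[of "h n (c n)" "h n c0"]
      by (simp add: blinfun.diff_right)
  qed
  then show False
    using weakly_null_imp_mean_abs_null[OF mean S C U(2) Us cC c0, of "\<epsilon> / 2"] \<epsilon> by simp
qed

section \<open>Rademacher averages over sign patterns\<close>

lemma sum_Pow_toggle_eq_0:
  fixes F :: "nat set \<Rightarrow> real"
  assumes n: "n < N" and tog: "\<And>\<sigma>. n \<notin> \<sigma> \<Longrightarrow> F (insert n \<sigma>) = - F \<sigma>"
  shows "(\<Sum>\<sigma>\<in>Pow {..<N}. F \<sigma>) = 0"
proof -
  \<comment> \<open>Toggling n is an involution of the cube that reverses the sign of
    \<open>F\<close>, so the sum equals its own negative.\<close>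
  let ?t = "\<lambda>\<sigma>. if n \<in> \<sigma> then \<sigma> - {n} else insert n \<sigma>"
  have "F (?t \<sigma>) = - F \<sigma>" for \<sigma>
  proof (cases "n \<in> \<sigma>")
    case True
    then show ?thesis using tog[of "\<sigma> - {n}"] by (simp add: insert_absorb)
  qed (use tog in simp)
  moreover have "(\<Sum>\<sigma>\<in>Pow {..<N}. F \<sigma>) = (\<Sum>\<sigma>\<in>Pow {..<N}. F (?t \<sigma>))"
    by (rule sum.reindex_bij_witness[of _ ?t ?t]) (use n in \<open>auto simp: insert_absorb\<close>)
  ultimately show ?thesis by (simp add: sum_negf)
qed

text \<open>The averages over the finite cubes, along an ultrafilter, replace the Haar measure of the
  Cantor cube, and the signs \<open>r n\<close> its Rademacher functions.\<close>

lemma independent_imp_uniformly_null_sequence: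
  fixes x :: "nat \<Rightarrow> 'a::real_normed_vector"
  assumes ab: "a < b"
    and indep: "\<And>(N::nat) \<sigma>. \<exists>g :: 'a \<Rightarrow>\<^sub>L real. norm g \<le> 1 \<and> (\<forall>i<N. if \<sigma> i then b \<le> blinfun_apply g (x i) else blinfun_apply g (x i) \<le> a)"
  obtains h :: "nat \<Rightarrow> 'a \<Rightarrow>\<^sub>L real" where
    "\<And>C \<epsilon>. compactin weak_topology C \<Longrightarrow> 0 < \<epsilon> \<Longrightarrow> eventually (\<lambda>n. \<forall>y\<in>C. \<bar>h n y\<bar> \<le> \<epsilon>) sequentially"
    "\<And>n. (b - a) / 2 \<le> h n (x n)"
proof -
  define S where "S = {g :: 'a \<Rightarrow>\<^sub>L real. norm g \<le> 1}"
  define G where "G N \<sigma> = (SOME g :: 'a \<Rightarrow>\<^sub>L real.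
    norm g \<le> 1 \<and> (\<forall>i<N. if i \<in> \<sigma> then b \<le> blinfun_apply g (x i) else blinfun_apply g (x i) \<le> a))" for N \<sigma>
  have G: "norm (G N \<sigma>) \<le> 1" "\<And>i. i < N \<Longrightarrow> if i \<in> \<sigma> then b \<le> G N \<sigma> (x i) else G N \<sigma> (x i) \<le> a" for N \<sigma>
    using someI_ex[OF indep[of N "\<lambda>i. i \<in> \<sigma>"]] unfolding G_def by blast+
  obtain U :: "nat filter" where U: "U \<le> sequentially" "ultra_on U"
    using ultrafilter_exists[of sequentially] by auto
  have nb: "U \<noteq> bot" using U by (simp add: ultra_on_def)
  have evU: "eventually P U" if "\<And>N. N > n \<Longrightarrow> P N" for P n
    using U(1) by (rule filter_leD) (use that in \<open>auto intro: eventually_mono[OF eventually_gt_at_top[of n]]\<close>)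
  define avg where "avg \<phi> N = (\<Sum>\<sigma>\<in>Pow {..<N}. \<phi> (G N \<sigma>)) / 2 ^ N" for \<phi> :: "('a \<Rightarrow>\<^sub>L real) \<Rightarrow> real" and N
  define m where "m \<phi> = Lim U (avg \<phi>)" for \<phi>
  have lim: "(avg \<phi> \<longlongrightarrow> m \<phi>) U" if b: "bounded (\<phi> ` S)" for \<phi>
  proof -
    obtain B where B: "\<And>g. g \<in> S \<Longrightarrow> \<bar>\<phi> g\<bar> \<le> B" using b by (auto simp: bounded_iff)
    have "\<bar>avg \<phi> N\<bar> \<le> B" for N
    proof -
      have "\<bar>\<Sum>\<sigma>\<in>Pow {..<N}. \<phi> (G N \<sigma>)\<bar> \<le> (\<Sum>\<sigma>\<in>Pow {..<N}. B)"
        using B G(1) by (intro order_trans[OF sum_abs] sum_mono) (auto simp: S_def)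
      also have "\<dots> = 2 ^ N * B" by (simp add: card_Pow)
      finally show ?thesis by (simp add: avg_def field_simps)
    qed
    then show ?thesis unfolding m_def by (rule ultra_on_tendsto_bounded[OF U(2)])
  qed
  have uniq: "m \<phi> = l" if "bounded (\<phi> ` S)" "(avg \<phi> \<longlongrightarrow> l) U" for \<phi> l
    using tendsto_unique[OF nb lim[OF that(1)] that(2)] .
  have mean: "finitely_additive_mean S m"
  proof
    have "avg (\<lambda>_. 1) = (\<lambda>_. 1)" by (auto simp: avg_def card_Pow)
    then show "m (\<lambda>_. 1) = 1" by (intro uniq) (auto simp: bounded_iff)
  next
    fix \<phi> \<psi> :: "('a \<Rightarrow>\<^sub>L real) \<Rightarrow> real" assume b: "bounded (\<phi> ` S)" "bounded (\<psi> ` S)"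
    have "avg (\<lambda>s. \<phi> s + \<psi> s) = (\<lambda>N. avg \<phi> N + avg \<psi> N)"
      by (auto simp: avg_def sum.distrib add_divide_distrib)
    then show "m (\<lambda>s. \<phi> s + \<psi> s) = m \<phi> + m \<psi>"
      using tendsto_add[OF lim[OF b(1)] lim[OF b(2)]] b by (intro uniq bounded_plus_comp) simp_all
  next
    fix \<phi> :: "('a \<Rightarrow>\<^sub>L real) \<Rightarrow> real" and c :: real assume b: "bounded (\<phi> ` S)"
    have "avg (\<lambda>s. c * \<phi> s) = (\<lambda>N. c * avg \<phi> N)"
      by (auto simp: avg_def sum_distrib_left)
    moreover have "bounded ((\<lambda>s. c * \<phi> s) ` S)"
      using bounded_scaling[OF b, of c] by (simp add: image_image)
    ultimately show "m (\<lambda>s. c * \<phi> s) = c * m \<phi>"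
      using tendsto_mult_left[OF lim[OF b], of c] by (intro uniq) simp_all
  next
    fix \<phi> :: "('a \<Rightarrow>\<^sub>L real) \<Rightarrow> real" assume b: "bounded (\<phi> ` S)" and nn: "\<And>s. s \<in> S \<Longrightarrow> 0 \<le> \<phi> s"
    have "0 \<le> avg \<phi> N" for N
      unfolding avg_def using nn G(1) by (intro divide_nonneg_pos sum_nonneg) (auto simp: S_def)
    then show "0 \<le> m \<phi>" by (intro tendsto_lowerbound[OF lim[OF b] _ nb]) simp
  qed
  interpret finitely_additive_mean S m by (rule mean)
  \<comment> \<open>The sign is read off from \<open>g\<close> itself; by a < b it agrees with the
    sign that the pattern \<sigma> prescribes at \<open>G N \<sigma>\<close> whenever n < N.\<close>
  define r where "r n g = (if b \<le> blinfun_apply g (x n) then 1 else -1 :: real)" for n and g :: "'a \<Rightarrow>\<^sub>L real"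
  have r1: "\<bar>r n g\<bar> = 1" for n g by (simp add: r_def)
  have br: "bounded (r n ` S)" for n using r1 by (auto simp: bounded_iff intro!: exI[of _ 1])
  have rG: "r n (G N \<sigma>) = (if n \<in> \<sigma> then 1 else -1)" if "n < N" for n N \<sigma>
    using G(2)[OF that, of \<sigma>] ab by (auto simp: r_def split: if_splits)
  have avg0: "m \<phi> = 0" if \<phi>: "bounded (\<phi> ` S)" "\<And>N. N > k \<Longrightarrow> avg \<phi> N = 0" for \<phi> k
  proof (rule uniq[OF \<phi>(1)])
    have "eventually (\<lambda>N. 0 = avg \<phi> N) U" by (rule evU[of k]) (use \<phi>(2) in simp)
    then show "(avg \<phi> \<longlongrightarrow> 0) U" by (rule Lim_transform_eventually[OF tendsto_const])
  qed
  have mr: "m (r n) = 0" for n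
  proof (rule avg0[OF br, of n])
    fix N assume "n < N"
    then have "(\<Sum>\<sigma>\<in>Pow {..<N}. r n (G N \<sigma>)) = 0"
      by (intro sum_Pow_toggle_eq_0[of n]) (auto simp: rG)
    then show "avg (r n) N = 0" by (simp add: avg_def)
  qed
  have orth: "m (\<lambda>g. r n g * r k g) = 0" if "n \<noteq> k" for n k
  proof (rule avg0[of _ "max n k"])
    show "bounded ((\<lambda>g. r n g * r k g) ` S)" by (intro bounded_mult br)
    fix N assume "max n k < N"
    then have "(\<Sum>\<sigma>\<in>Pow {..<N}. r n (G N \<sigma>) * r k (G N \<sigma>)) = 0"
      using that by (intro sum_Pow_toggle_eq_0[of n]) (auto simp: rG)
    then show "avg (\<lambda>g. r n g * r k g) N = 0" by (simp add: avg_def)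
  qed
  have gb: "\<bar>blinfun_apply g y\<bar> \<le> norm y" if "g \<in> S" for g y
    using norm_blinfun[of g y] mult_right_mono[of "norm g" 1 "norm y"] that by (simp add: S_def)
  have gB: "bounded ((\<lambda>g. blinfun_apply g y) ` S)" for y
    using gb by (auto simp: bounded_iff)
  have bry: "bounded ((\<lambda>g. r n g * blinfun_apply g y) ` S)" for n y
    by (intro bounded_mult br gB)
  define H where "H n y = m (\<lambda>g. r n g * blinfun_apply g y)" for n y
  have dom: "\<bar>H n y\<bar> \<le> m (\<lambda>g. \<bar>blinfun_apply g y\<bar>)" for n y
    using abs_le[OF bry[of n y]] by (simp add: H_def abs_mult r1)
  have "bounded_linear (H n)" for n
  proof (rule bounded_linear_intro)
    show "H n (y + z) = H n y + H n z" for y z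
      using add[OF bry[of n y] bry[of n z]] by (simp add: H_def blinfun.add_right distrib_left)
    show "H n (c *\<^sub>R y) = c *\<^sub>R H n y" for c y
      using scale[OF bry[of n y], of c] by (simp add: H_def blinfun.scaleR_right mult_ac)
    show "norm (H n y) \<le> norm y * 1" for y
    proof -
      have "m (\<lambda>g. \<bar>blinfun_apply g y\<bar>) \<le> m (\<lambda>_. norm y)"
        using gb by (intro mono) (auto simp: bounded_iff)
      then show ?thesis using dom[of n y] by (simp add: const)
    qed
  qed
  then have Happ: "blinfun_apply (Blinfun (H n)) y = H n y" for n y
    by (simp add: bounded_linear_Blinfun_apply)
  have null: "(\<lambda>n. H n y) \<longlonglongrightarrow> 0" for y
  proof -
    have "(\<Sum>n<N. (H n y)\<^sup>2) \<le> m (\<lambda>g. (blinfun_apply g y)\<^sup>2)" for N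
      unfolding H_def by (rule Bessel[OF r1 orth gB]) simp_all
    then have "summable (\<lambda>n. (H n y)\<^sup>2)"
      by (intro bounded_imp_summable[of _ "m (\<lambda>g. (blinfun_apply g y)\<^sup>2)"])
         (simp_all only: lessThan_Suc_atMost[symmetric] zero_le_power2)
    then have "(\<lambda>n. (H n y)\<^sup>2) \<longlonglongrightarrow> 0" by (rule summable_LIMSEQ_zero)
    then show ?thesis by simp
  qed
  have low: "(b - a) / 2 \<le> H n (x n)" for n
  proof -
    \<comment> \<open>Subtracting the midpoint (a + b) / 2 does not change \<open>H n (x n)\<close>,
      because \<open>r n\<close> has mean 0, and makes both signs contribute at least (b - a) /
      2.\<close>
    let ?\<phi> = "\<lambda>g :: 'a \<Rightarrow>\<^sub>L real. r n g * blinfun_apply g (x n) - (a + b) / 2 * r n g"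
    have bd: "bounded ((\<lambda>g. (a + b) / 2 * r n g) ` S)" by (intro bounded_mult br) simp
    then have b\<phi>: "bounded (?\<phi> ` S)" by (intro bounded_minus_comp bry)
    have "(b - a) / 2 \<le> m ?\<phi>"
    proof (rule tendsto_lowerbound[OF lim[OF b\<phi>] _ nb], rule evU[of n])
      fix N assume N: "n < N"
      have "(b - a) / 2 \<le> ?\<phi> (G N \<sigma>)" for \<sigma>
        using G(2)[OF N, of \<sigma>] rG[OF N, of \<sigma>] by (simp add: field_simps split: if_splits)
      then have "(\<Sum>\<sigma>\<in>Pow {..<N}. (b - a) / 2) \<le> (\<Sum>\<sigma>\<in>Pow {..<N}. ?\<phi> (G N \<sigma>))"
        by (intro sum_mono)
      then show "(b - a) / 2 \<le> avg ?\<phi> N" by (simp add: avg_def card_Pow field_simps)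
    qed
    also have "m ?\<phi> = H n (x n)"
      using diff[OF bry[of n "x n"] bd] scale[OF br[of n], of "(a + b) / 2"] by (simp add: mr H_def)
    finally show ?thesis .
  qed
  show thesis
  proof (rule that[of "\<lambda>n. Blinfun (H n)"])
    fix C :: "'a set" and \<epsilon> :: real
    assume "compactin weak_topology C" "0 < \<epsilon>"
    then show "eventually (\<lambda>n. \<forall>y\<in>C. \<bar>blinfun_apply (Blinfun (H n)) y\<bar> \<le> \<epsilon>) sequentially"
      using null dom by (intro mean_dominated_imp_uniformly_null[OF mean]) (auto simp: S_def Happ)
  next
    show "(b - a) / 2 \<le> blinfun_apply (Blinfun (H n)) (x n)" for n using low by (simp add: Happ)
  qed
qed

section \<open>The Mackey topology\<close>

lemma openin_mackey_dual_topology: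
  "openin (mackey_dual_topology :: ('a::real_normed_vector \<Rightarrow>\<^sub>L real) topology) U \<longleftrightarrow>
    (\<forall>f\<in>U. \<exists>\<F> e. finite \<F> \<and> (\<forall>K\<in>\<F>. compactin weak_topology K \<and> absolutely_convex K) \<and> e > 0 \<and>
      (\<forall>g. (\<forall>K\<in>\<F>. \<forall>x\<in>K. \<bar>blinfun_apply g x - blinfun_apply f x\<bar> \<le> e) \<longrightarrow> g \<in> U))"
  unfolding mackey_dual_topology_def openin_uniform_convergence_topology
  by (simp only: subset_iff mem_Collect_eq Ball_def)

lemma openin_mackeyD:
  fixes U :: "('a::real_normed_vector \<Rightarrow>\<^sub>L real) set"
  assumes "openin mackey_dual_topology U" "f \<in> U"
  shows "\<exists>\<F> e. finite \<F> \<and> (\<forall>K\<in>\<F>. compactin weak_topology K \<and> absolutely_convex K) \<and> e > 0 \<and>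
    (\<forall>g. (\<forall>K\<in>\<F>. \<forall>x\<in>K. \<bar>blinfun_apply g x - blinfun_apply f x\<bar> \<le> e) \<longrightarrow> g \<in> U)"
  using assms(2) by (rule bspec[OF assms(1)[unfolded openin_mackey_dual_topology]])

lemma topspace_mackey_dual_topology [simp]:
  "topspace (mackey_dual_topology :: ('a::real_normed_vector \<Rightarrow>\<^sub>L real) topology) = UNIV"
proof -
  have "openin (mackey_dual_topology :: ('a \<Rightarrow>\<^sub>L real) topology) UNIV"
    unfolding openin_mackey_dual_topology by (intro ballI exI[of _ "{}"] exI[of _ 1]) auto
  then show ?thesis by (meson openin_subset top.extremum_uniqueI)
qed

lemma openin_mackey_translation:
  fixes U :: "('a::real_normed_vector \<Rightarrow>\<^sub>L real) set"
  assumes "openin mackey_dual_topology U"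
  shows "openin mackey_dual_topology ((+) l ` U)"
  unfolding openin_mackey_dual_topology
proof
  fix f assume "f \<in> (+) l ` U"
  then obtain u where u: "u \<in> U" "f = l + u" by blast
  obtain \<F> e where F: "finite \<F>" "\<forall>K\<in>\<F>. compactin weak_topology K \<and> absolutely_convex K" "e > 0"
    "\<forall>g. (\<forall>K\<in>\<F>. \<forall>x\<in>K. \<bar>blinfun_apply g x - blinfun_apply u x\<bar> \<le> e) \<longrightarrow> g \<in> U"
    using openin_mackeyD[OF assms u(1)] by blast
  have "g \<in> (+) l ` U" if g: "\<forall>K\<in>\<F>. \<forall>x\<in>K. \<bar>blinfun_apply g x - blinfun_apply f x\<bar> \<le> e" for g
  proof (rule image_eqI)
    have "\<forall>K\<in>\<F>. \<forall>x\<in>K. \<bar>blinfun_apply (g - l) x - blinfun_apply u x\<bar> \<le> e"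
      using g by (simp add: u blinfun.diff_left blinfun.add_left diff_diff_eq)
    with F(4) show "g - l \<in> U" by blast
  qed simp
  with F(1-3) show "\<exists>\<F> e. finite \<F> \<and> (\<forall>K\<in>\<F>. compactin weak_topology K \<and> absolutely_convex K) \<and> e > 0 \<and>
      (\<forall>g. (\<forall>K\<in>\<F>. \<forall>x\<in>K. \<bar>blinfun_apply g x - blinfun_apply f x\<bar> \<le> e) \<longrightarrow> g \<in> (+) l ` U)"
    by (intro exI[of _ \<F>] exI[of _ e]) simp
qed

lemma zero_in_polar: "0 < e \<Longrightarrow> (0 :: 'a::real_normed_vector \<Rightarrow>\<^sub>L real) \<in> {f. \<exists>d<e. \<forall>x\<in>K. \<bar>blinfun_apply f x\<bar> \<le> d}"
  by (auto intro!: exI[of _ 0])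

text \<open>The gap between d and e makes this version of the polar open: half of it is left for
  perturbations of \<open>f\<close>.\<close>

lemma openin_mackey_polar:
  fixes K :: "'a::real_normed_vector set"
  assumes "compactin weak_topology K" "absolutely_convex K"
  shows "openin mackey_dual_topology {f. \<exists>d<e. \<forall>x\<in>K. \<bar>blinfun_apply f x\<bar> \<le> d}"
  unfolding openin_mackey_dual_topology
proof
  fix f :: "'a \<Rightarrow>\<^sub>L real" assume "f \<in> {f. \<exists>d<e. \<forall>x\<in>K. \<bar>blinfun_apply f x\<bar> \<le> d}"
  then obtain d where d: "d < e" "\<And>x. x \<in> K \<Longrightarrow> \<bar>f x\<bar> \<le> d" by blast
  have "\<exists>d<e. \<forall>x\<in>K. \<bar>blinfun_apply g x\<bar> \<le> d"
    if "\<forall>x\<in>K. \<bar>blinfun_apply g x - blinfun_apply f x\<bar> \<le> (e - d) / 2" for g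
  proof (intro exI[of _ "d + (e - d) / 2"] conjI ballI)
    show "d + (e - d) / 2 < e" using d(1) by (simp add: field_simps)
    show "\<bar>blinfun_apply g x\<bar> \<le> d + (e - d) / 2" if "x \<in> K" for x
      using d(2)[OF that] bspec[OF \<open>\<forall>x\<in>K. _ x\<close> that] by linarith
  qed
  with assms d(1) show "\<exists>\<F> e'. finite \<F> \<and> (\<forall>K\<in>\<F>. compactin weak_topology K \<and> absolutely_convex K) \<and> e' > 0 \<and>
      (\<forall>g. (\<forall>K\<in>\<F>. \<forall>x\<in>K. \<bar>blinfun_apply g x - blinfun_apply f x\<bar> \<le> e') \<longrightarrow>
         g \<in> {f. \<exists>d<e. \<forall>x\<in>K. \<bar>blinfun_apply f x\<bar> \<le> d})"
    by (intro exI[of _ "{K}"] exI[of _ "(e - d) / 2"]) auto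
qed

text \<open>The sequence x, 0, 0, ... is weakly null. Mackey neighbourhoods therefore control the
  values at single points.\<close>

lemma weakly_compact_absolutely_convex_contains:
  fixes x :: "'a::banach"
  obtains K where "compactin weak_topology K" "absolutely_convex K" "x \<in> K"
proof -
  let ?y = "\<lambda>n::nat. if n = 0 then x else 0"
  have "eventually (\<lambda>n. blinfun_apply f (?y n) = 0) sequentially" for f :: "'a \<Rightarrow>\<^sub>L real"
    using eventually_gt_at_top[of 0] by eventually_elim simp
  then have "(\<lambda>n. blinfun_apply f (?y n)) \<longlonglongrightarrow> 0" for f :: "'a \<Rightarrow>\<^sub>L real"
    by (rule tendsto_eventually)
  moreover have "norm (?y n) \<le> norm x" for n by simp
  ultimately obtain K where "compactin weak_topology K" "absolutely_convex K" "range ?y \<subseteq> K"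
    using weakly_null_sequence_in_weakly_compact[of ?y "norm x"] by blast
  moreover from this(3) have "x \<in> K" by (auto dest: subsetD[of _ _ "?y 0"])
  ultimately show thesis using that by blast
qed

text \<open>The finitely many weakly compact sets behind a Mackey neighbourhood have a common bound,
  so a small norm ball meets their constraints.\<close>

lemma openin_mackey_imp_open:
  fixes U :: "('a::real_normed_vector \<Rightarrow>\<^sub>L real) set"
  assumes "openin mackey_dual_topology U"
  shows "open U"
  unfolding open_contains_ball
proof
  fix f assume "f \<in> U"
  then obtain \<F> e where F: "finite \<F>" "\<forall>K\<in>\<F>. compactin weak_topology K \<and> absolutely_convex K" "e > 0"
    "\<forall>g. (\<forall>K\<in>\<F>. \<forall>x\<in>K. \<bar>blinfun_apply g x - blinfun_apply f x\<bar> \<le> e) \<longrightarrow> g \<in> U"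
    using openin_mackeyD[OF assms \<open>f \<in> U\<close>] by blast
  have "compactin weak_topology (\<Union>\<F>)" using F(1,2) by (intro compactin_Union) auto
  then obtain M where M: "M > 0" "\<And>x (f :: 'a \<Rightarrow>\<^sub>L real). x \<in> \<Union>\<F> \<Longrightarrow> \<bar>blinfun_apply f x\<bar> \<le> M * norm f"
    using weakly_compact_bound by blast
  have "ball f (e / M) \<subseteq> U"
  proof
    fix g assume "g \<in> ball f (e / M)"
    then have "M * norm (g - f) \<le> e"
      using M(1) by (simp add: dist_norm norm_minus_commute field_simps)
    then have "\<forall>K\<in>\<F>. \<forall>x\<in>K. \<bar>blinfun_apply (g - f) x\<bar> \<le> e"
      using order_trans[OF M(2)[of _ "g - f"]] by blast
    then show "g \<in> U" using F(4) by (simp add: blinfun.diff_left)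
  qed
  then show "\<exists>e>0. ball f e \<subseteq> U" using M(1) F(3) by (intro exI[of _ "e / M"]) auto
qed

section \<open>Bounded sets and the bound extension\<close>

lemma absorbs_imp_subset_scaled:
  assumes "absorbs V B"
  shows "\<exists>r>0. B \<subseteq> (\<lambda>x. r *\<^sub>R x) ` V"
proof -
  obtain r where r: "r > 0" "\<And>c::real. \<bar>c\<bar> \<ge> r \<Longrightarrow> B \<subseteq> (\<lambda>x. c *\<^sub>R x) ` V"
    using assms unfolding absorbs_def by blast
  from r(2)[of r] r(1) show ?thesis by (intro exI[of _ r]) simp
qed

lemma absorbs_ball:
  fixes B :: "'b::real_normed_vector set"
  assumes "bounded B" "0 < \<delta>"
  shows "absorbs (ball 0 \<delta>) B"
proof -
  obtain M where M: "M > 0" "\<And>f. f \<in> B \<Longrightarrow> norm f \<le> M"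
    using assms(1) bounded_pos by blast
  \<comment> \<open>The factor 2 gives the strict inequality that the open ball demands.\<close>
  have "B \<subseteq> (\<lambda>x. c *\<^sub>R x) ` ball 0 \<delta>" if "\<bar>c\<bar> \<ge> 2 * M / \<delta>" for c :: real
  proof
    fix f assume "f \<in> B"
    have "0 < 2 * M / \<delta>" using M(1) assms(2) by simp
    then have c: "c \<noteq> 0" "\<bar>c\<bar> > 0" using that by auto
    have "norm f < \<bar>c\<bar> * \<delta>" using M(1) M(2)[OF \<open>f \<in> B\<close>] that assms(2) by (simp add: field_simps)
    then have "norm (inverse c *\<^sub>R f) < \<delta>" using c by (simp add: field_simps)
    moreover have "f = c *\<^sub>R (inverse c *\<^sub>R f)" using c by simp
    ultimately show "f \<in> (\<lambda>x. c *\<^sub>R x) ` ball 0 \<delta>" by (intro image_eqI[of _ _ "inverse c *\<^sub>R f"]) auto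
  qed
  moreover have "0 < 2 * M / \<delta>" using M(1) assms(2) by simp
  ultimately show ?thesis unfolding absorbs_def by blast
qed

text \<open>Every point lies in a weakly compact absolutely convex set, so a Mackey bounded set is
  pointwise bounded and uniform boundedness applies. The converse holds because Mackey
  neighbourhoods of 0 contain norm balls.\<close>

lemma bounded_in_mackey_iff:
  fixes B :: "('a::banach \<Rightarrow>\<^sub>L real) set"
  shows "bounded_in mackey_dual_topology B \<longleftrightarrow> bounded B"
proof
  assume B: "bounded_in mackey_dual_topology B"
  have "\<exists>c. \<forall>f\<in>B. \<bar>blinfun_apply f x\<bar> \<le> c" for x
  proof -
    obtain K where K: "compactin weak_topology K" "absolutely_convex K" "x \<in> K"
      by (rule weakly_compact_absolutely_convex_contains)
    have "absorbs {f. \<exists>d<1. \<forall>x\<in>K. \<bar>blinfun_apply f x\<bar> \<le> d} B"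
      using B openin_mackey_polar[OF K(1,2), of 1] zero_in_polar[of 1 K] by (simp only: bounded_in_def zero_less_one)
    then obtain r where r: "r > 0" "B \<subseteq> (\<lambda>f. r *\<^sub>R f) ` {f. \<exists>d<1. \<forall>x\<in>K. \<bar>blinfun_apply f x\<bar> \<le> d}"
      using absorbs_imp_subset_scaled by blast
    have "\<bar>blinfun_apply f x\<bar> \<le> r" if "f \<in> B" for f
    proof -
      obtain u d where u: "f = r *\<^sub>R u" "d < 1" "\<bar>blinfun_apply u x\<bar> \<le> d" using r(2) \<open>f \<in> B\<close> K(3) by blast
      then have "r * \<bar>blinfun_apply u x\<bar> \<le> r * 1" using r(1) by (intro mult_left_mono) auto
      then show ?thesis using r(1) by (simp add: u blinfun.scaleR_left abs_mult)
    qed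
    then show ?thesis by blast
  qed
  then have "\<exists>c. \<forall>f\<in>B. norm f \<le> c" by (rule uniform_boundedness)
  then show "bounded B" by (simp add: bounded_iff)
next
  assume B: "bounded B"
  show "bounded_in mackey_dual_topology B"
    unfolding bounded_in_def
  proof (intro allI impI)
    fix U :: "('a \<Rightarrow>\<^sub>L real) set" assume "openin mackey_dual_topology U \<and> 0 \<in> U"
    then have "open U" "0 \<in> U" using openin_mackey_imp_open by auto
    then obtain \<delta> where "\<delta> > 0" "ball 0 \<delta> \<subseteq> U" using open_contains_ball by blast
    then show "absorbs U B" using absorbs_ball[OF B] absorbs_mono by blast
  qed
qed

text \<open>A set that absorbs the unit ball contains a ball, and balls around 0 are circled, convex
  and absorb all bounded sets.\<close>

lemma bound_extension_mackey:
  "bound_extension (mackey_dual_topology :: ('a::banach \<Rightarrow>\<^sub>L real) topology) = euclidean"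
  unfolding topology_eq
proof (intro allI iffI)
  fix U :: "('a \<Rightarrow>\<^sub>L real) set"
  assume U: "openin (bound_extension mackey_dual_topology) U"
  have "\<exists>e>0. ball x e \<subseteq> U" if "x \<in> U" for x
  proof -
    obtain V where V: "\<forall>B :: ('a \<Rightarrow>\<^sub>L real) set. bounded B \<longrightarrow> absorbs V B" "(+) x ` V \<subseteq> U"
      using U \<open>x \<in> U\<close> unfolding openin_bound_extension bounded_in_mackey_iff by blast
    then have "absorbs V (cball 0 1)" by simp
    then obtain r where r: "r > 0" "cball 0 1 \<subseteq> (\<lambda>x. r *\<^sub>R x) ` V"
      using absorbs_imp_subset_scaled by blast
    have "ball x (1 / r) \<subseteq> U"
    proof
      fix z assume z: "z \<in> ball x (1 / r)"
      have "r *\<^sub>R (z - x) \<in> cball 0 1"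
      proof -
        have "norm (r *\<^sub>R (z - x)) = r * norm (z - x)" using r(1) by simp
        also have "\<dots> \<le> r * (1 / r)"
          using z r(1) by (intro mult_left_mono) (auto simp: dist_norm norm_minus_commute)
        finally show ?thesis using r(1) by simp
      qed
      then obtain v where "v \<in> V" "r *\<^sub>R (z - x) = r *\<^sub>R v" using r(2) by blast
      then have "z = x + v" "v \<in> V" using r(1) by auto
      then show "z \<in> U" using V(2) by blast
    qed
    then show ?thesis using r(1) by (intro exI[of _ "1 / r"]) auto
  qed
  then show "openin euclidean U" by (simp add: open_contains_ball)
next
  fix U :: "('a \<Rightarrow>\<^sub>L real) set"
  assume U: "openin euclidean U"
  show "openin (bound_extension mackey_dual_topology) U"
    unfolding openin_bound_extension bounded_in_mackey_iff
  proof
    fix x assume "x \<in> U"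
    then obtain e where e: "e > 0" "ball x e \<subseteq> U" using U by (auto elim: openE)
    have "norm (c *\<^sub>R y) < e" if "\<bar>c\<bar> \<le> 1" "norm y < e" for c and y :: "'a \<Rightarrow>\<^sub>L real"
      using mult_right_mono[of "\<bar>c\<bar>" 1 "norm y"] that by simp
    then have "circled (ball (0 :: 'a \<Rightarrow>\<^sub>L real) e)" by (auto simp: circled_def)
    moreover have "(+) x ` ball 0 e \<subseteq> U" using e(2) by (auto simp: dist_norm)
    ultimately show "\<exists>V. circled V \<and> convex V \<and> (\<forall>B :: ('a \<Rightarrow>\<^sub>L real) set. bounded B \<longrightarrow> absorbs V B) \<and> (+) x ` V \<subseteq> U"
      using absorbs_ball[OF _ e(1)] by (intro exI[of _ "ball 0 e"]) auto
  qed
qed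

section \<open>Precompact sets and locally convex topologies\<close>

lemma locally_convex_topology_euclidean:
  "locally_convex_topology (euclidean :: 'b::real_normed_vector topology)"
  unfolding locally_convex_topology_def
proof (intro conjI allI impI)
  show "continuous_map (prod_topology euclidean euclidean) euclidean (\<lambda>(x, y :: 'b). x + y)"
    by (auto simp: case_prod_unfold intro!: continuous_intros)
  show "continuous_map (prod_topology euclideanreal euclidean) euclidean (\<lambda>(c, x :: 'b). c *\<^sub>R x)"
    by (auto simp: case_prod_unfold intro!: continuous_intros)
  fix U :: "'b set" assume "openin euclidean U \<and> 0 \<in> U"
  then obtain e where "e > 0" "ball 0 e \<subseteq> U" by (auto elim: openE)
  then show "\<exists>V. openin euclidean V \<and> 0 \<in> V \<and> convex V \<and> V \<subseteq> U" by (intro exI[of _ "ball 0 e"]) auto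
qed simp

lemma precompact_in_euclidean:
  fixes S :: "'b::real_normed_vector set"
  shows "precompact_in euclidean S \<longleftrightarrow> (\<forall>e>0. \<exists>F. finite F \<and> S \<subseteq> (\<Union>x\<in>F. ball x e))"
proof
  assume S: "precompact_in euclidean S"
  show "\<forall>e>0. \<exists>F. finite F \<and> S \<subseteq> (\<Union>x\<in>F. ball x e)"
  proof (intro allI impI)
    fix e :: real assume "e > 0"
    then have "openin euclidean (ball (0 :: 'b) e) \<and> 0 \<in> ball (0 :: 'b) e" by simp
    then obtain F where "finite F" "S \<subseteq> (\<Union>x\<in>F. (+) x ` ball 0 e)"
      using S unfolding precompact_in_def by blast
    moreover have "(+) x ` ball 0 e = ball x e" for x :: 'b by simp
    ultimately show "\<exists>F. finite F \<and> S \<subseteq> (\<Union>x\<in>F. ball x e)" by auto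
  qed
next
  assume S: "\<forall>e>0. \<exists>F. finite F \<and> S \<subseteq> (\<Union>x\<in>F. ball x e)"
  show "precompact_in euclidean S" unfolding precompact_in_def
  proof (intro allI impI)
    fix U :: "'b set" assume "openin euclidean U \<and> 0 \<in> U"
    then obtain e where e: "e > 0" "ball 0 e \<subseteq> U" by (auto elim: openE)
    then obtain F where F: "finite F" "S \<subseteq> (\<Union>x\<in>F. ball x e)" using S by blast
    have "ball x e \<subseteq> (+) x ` U" for x
    proof
      fix z assume "z \<in> ball x e"
      then have "z - x \<in> U" using e(2) by (auto simp: dist_norm norm_minus_commute)
      then show "z \<in> (+) x ` U" by (intro image_eqI[of _ _ "z - x"]) auto
    qed
    then have "(\<Union>x\<in>F. ball x e) \<subseteq> (\<Union>x\<in>F. (+) x ` U)" by (intro UN_mono) auto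
    with F(2) have "S \<subseteq> (\<Union>x\<in>F. (+) x ` U)" by (rule order_trans)
    with F(1) show "\<exists>F. finite F \<and> S \<subseteq> (\<Union>x\<in>F. (+) x ` U)" by (intro exI[of _ F] conjI)
  qed
qed

lemma precompact_in_euclidean_null_sequence:
  fixes y :: "nat \<Rightarrow> 'b::real_normed_vector"
  assumes "y \<longlonglongrightarrow> 0"
  shows "precompact_in euclidean (range y)"
  unfolding precompact_in_euclidean
proof (intro allI impI)
  fix e :: real assume "e > 0"
  then obtain N where N: "\<And>n. n \<ge> N \<Longrightarrow> y n \<in> ball 0 e"
    using tendstoD[OF assms] by (auto simp: eventually_sequentially)
  have "range y \<subseteq> (\<Union>x\<in>insert 0 (y ` {..<N}). ball x e)"
  proof
    fix z assume "z \<in> range y"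
    then obtain n where "z = y n" by blast
    then show "z \<in> (\<Union>x\<in>insert 0 (y ` {..<N}). ball x e)"
    proof (cases "N \<le> n")
      case True
      then show ?thesis using N[of n] \<open>z = y n\<close> by auto
    next
      case False
      then show ?thesis using \<open>e > 0\<close> \<open>z = y n\<close> by (intro UN_I[of "y n"]) auto
    qed
  qed
  then show "\<exists>F. finite F \<and> range y \<subseteq> (\<Union>x\<in>F. ball x e)"
    by (intro exI[of _ "insert 0 (y ` {..<N})"] conjI) simp_all
qed

text \<open>Precompact sets are bounded, in a form that suits a convex \<open>V\<close> around 0:
  finitely many centres are absorbed by continuity of scalar multiplication, and convexity combines
  them with \<open>V\<close>.\<close>

lemma precompact_absorbed:
  assumes Q: "locally_convex_topology Q" and V: "openin Q V" "0 \<in> V" "convex V"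
    and S: "precompact_in Q S"
  shows "\<exists>t>0. \<forall>s\<in>S. t *\<^sub>R s \<in> V"
proof -
  have shrink: "c' *\<^sub>R f \<in> V" if "c *\<^sub>R f \<in> V" "0 \<le> c'" "c' \<le> c" for c c' f
  proof (cases "c = 0")
    case False
    then have "(1 - c' / c) *\<^sub>R 0 + (c' / c) *\<^sub>R (c *\<^sub>R f) \<in> V"
      using that V(2) by (intro convexD[OF V(3)]) (auto simp: divide_le_eq)
    then show ?thesis using False by simp
  qed (use that in simp)
  have pt: "\<exists>c>0. c *\<^sub>R f \<in> V" for f
  proof -
    have "continuous_map euclideanreal (prod_topology euclideanreal Q) (\<lambda>c. (c, f))"
      using Q by (simp add: continuous_map_pairwise o_def locally_convex_topology_def)
    moreover have "continuous_map (prod_topology euclideanreal Q) Q (\<lambda>(c, x). c *\<^sub>R x)"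
      using Q by (simp add: locally_convex_topology_def)
    ultimately have "continuous_map euclideanreal Q ((\<lambda>(c, x). c *\<^sub>R x) \<circ> (\<lambda>c. (c, f)))"
      by (rule continuous_map_compose)
    then have "open {c. c *\<^sub>R f \<in> V}"
      using V(1) by (auto simp: continuous_map_def o_def)
    moreover have "0 \<in> {c. c *\<^sub>R f \<in> V}" using V(2) by simp
    ultimately obtain e where e: "e > 0" "ball 0 e \<subseteq> {c. c *\<^sub>R f \<in> V}"
      unfolding open_contains_ball by blast
    then have "(e / 2) *\<^sub>R f \<in> V" by (auto simp: subset_iff)
    then show ?thesis using e(1) by (intro exI[of _ "e / 2"]) simp
  qed
  obtain F where F: "finite F" "S \<subseteq> (\<Union>x\<in>F. (+) x ` V)"
    using S V unfolding precompact_in_def by blast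
  have "\<exists>c>0. c \<le> 1 \<and> (\<forall>f\<in>F. c *\<^sub>R f \<in> V)"
    using F(1)
  proof (induction F rule: finite_induct)
    case empty
    then show ?case by (intro exI[of _ 1]) simp
  next
    case (insert f F)
    then obtain c where c: "c > 0" "c \<le> 1" "\<forall>f\<in>F. c *\<^sub>R f \<in> V" by blast
    obtain c' where c': "c' > 0" "c' *\<^sub>R f \<in> V" using pt by blast
    have "min c c' *\<^sub>R g \<in> V" if "g \<in> insert f F" for g
      using that c c' shrink[of c g "min c c'"] shrink[of c' g "min c c'"] by auto
    then show ?case using c c' by (intro exI[of _ "min c c'"]) auto
  qed
  then obtain c where c: "c > 0" "c \<le> 1" "\<forall>f\<in>F. c *\<^sub>R f \<in> V" by blast
  \<comment> \<open>\<open>(c / 2) *\<^sub>R s\<close> is the midpoint of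
    \<open>c *\<^sub>R f\<close> and \<open>c *\<^sub>R v\<close>, both in \<open>V\<close>.\<close>
  have "(c / 2) *\<^sub>R s \<in> V" if s: "s \<in> S" for s
  proof -
    obtain f v where "f \<in> F" "v \<in> V" "s = f + v" using F(2) s by blast
    moreover then have "c *\<^sub>R v \<in> V" using shrink[of 1 v c] c by simp
    ultimately have "(1/2) *\<^sub>R (c *\<^sub>R f) + (1/2) *\<^sub>R (c *\<^sub>R v) \<in> V"
      using c V(3) by (intro convexD) auto
    then show ?thesis using \<open>s = f + v\<close> by (simp add: scaleR_right_distrib)
  qed
  then show ?thesis using c(1) by (intro exI[of _ "c / 2"]) auto
qed

text \<open>If \<open>V\<close> contained no ball, there would be \<open>x\<^sub>n \<notin> V\<close> with \<open>n x\<^sub>n \<rightarrow> 0\<close>; but the precompact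
  set of these multiples is absorbed by \<open>V\<close>.\<close>

lemma open_if_precompact_sets_preserved:
  fixes Q :: "'b::real_normed_vector topology"
  assumes Q: "locally_convex_topology Q"
    and pc: "\<And>S. precompact_in euclidean S \<Longrightarrow> precompact_in Q S"
    and U: "openin Q U"
  shows "open U"
  unfolding open_contains_ball
proof
  fix a assume "a \<in> U"
  have "continuous_map Q (prod_topology Q Q) (\<lambda>v. (a, v))"
    using Q by (simp add: continuous_map_pairwise o_def locally_convex_topology_def)
  moreover have "continuous_map (prod_topology Q Q) Q (\<lambda>(x, y). x + y)"
    using Q by (simp add: locally_convex_topology_def)
  ultimately have "continuous_map Q Q ((\<lambda>(x, y). x + y) \<circ> (\<lambda>v. (a, v)))"
    by (rule continuous_map_compose)
  then have "openin Q {v. a + v \<in> U}"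
    using U Q by (auto simp: continuous_map_def o_def locally_convex_topology_def)
  then obtain V where V: "openin Q V" "0 \<in> V" "convex V" "V \<subseteq> {v. a + v \<in> U}"
  proof -
    have "0 \<in> {v. a + v \<in> U}" using \<open>a \<in> U\<close> by simp
    with \<open>openin Q {v. a + v \<in> U}\<close> Q that show thesis
      unfolding locally_convex_topology_def by blast
  qed
  have "\<exists>e>0. ball 0 e \<subseteq> V"
  proof (rule ccontr)
    assume "\<not> ?thesis"
    \<comment> \<open>The quadratic radius leaves the multiples \<open>y n\<close> of
      \<open>x n\<close> by n + 1 null.\<close>
    then have "\<exists>x. x \<in> ball 0 (inverse (real (Suc n)) * inverse (real (Suc n))) \<and> x \<notin> V" for n
      by (meson inverse_positive_iff_positive mult_pos_pos of_nat_0_less_iff subsetI zero_less_Suc)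
    then obtain x where x: "\<And>n. norm (x n) < inverse (real (Suc n)) * inverse (real (Suc n))" "\<And>n. x n \<notin> V"
      unfolding mem_ball dist_0_norm by metis
    define y where "y n = real (Suc n) *\<^sub>R x n" for n
    have "y \<longlonglongrightarrow> 0"
    proof (rule Lim_null_comparison[OF _ LIMSEQ_inverse_real_of_nat])
      have "norm (y n) \<le> inverse (real (Suc n))" for n
      proof -
        have "norm (y n) = real (Suc n) * norm (x n)" by (simp add: y_def)
        also have "\<dots> \<le> real (Suc n) * (inverse (real (Suc n)) * inverse (real (Suc n)))"
          using x(1)[of n] by (intro mult_left_mono) auto
        also have "\<dots> = inverse (real (Suc n))" by (simp add: mult.assoc[symmetric] del: of_nat_Suc)
        finally show ?thesis .
      qed
      then show "eventually (\<lambda>n. norm (y n) \<le> inverse (real (Suc n))) sequentially" by simp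
    qed
    then obtain t where t: "t > 0" "\<And>n. t *\<^sub>R y n \<in> V"
      using precompact_absorbed[OF Q V(1-3) pc[OF precompact_in_euclidean_null_sequence]] by blast
    obtain n where "1 / t < real n" using reals_Archimedean2 by blast
    then have n: "1 \<le> t * real (Suc n)" using t(1) by (simp add: field_simps)
    let ?c = "t * real (Suc n)"
    \<comment> \<open>As \<open>?c\<close> is at least 1, \<open>x n\<close> is a convex combination
      of 0 and \<open>t *\<^sub>R y n\<close>.\<close>
    have "(1 - 1 / ?c) *\<^sub>R 0 + (1 / ?c) *\<^sub>R (t *\<^sub>R y n) \<in> V"
      using n V(2,3) t(2) by (intro convexD) auto
    moreover have "(1 / ?c) *\<^sub>R (t *\<^sub>R y n) = x n" using t(1) by (simp add: y_def)
    ultimately show False using x(2) by simp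
  qed
  then obtain e where e: "e > 0" "ball 0 e \<subseteq> V" by blast
  have "ball a e \<subseteq> U"
  proof
    fix z assume "z \<in> ball a e"
    then have "z - a \<in> V" using e(2) by (auto simp: dist_norm norm_minus_commute)
    then show "z \<in> U" using V(4) by auto
  qed
  then show "\<exists>e>0. ball a e \<subseteq> U" using e(1) by blast
qed

section \<open>Equal precompact sets imply sequential reflexivity\<close>

lemma same_precompact_sets_imp_sequentially_reflexive:
  assumes pc: "\<And>S :: ('a::banach \<Rightarrow>\<^sub>L real) set. precompact_in mackey_dual_topology S \<Longrightarrow> precompact_in euclidean S"
  shows "sequentially_reflexive TYPE('a)"
  unfolding sequentially_reflexive_def
proof (intro allI impI)
  fix f :: "nat \<Rightarrow> 'a \<Rightarrow>\<^sub>L real"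
  assume "\<exists>l. limitin mackey_dual_topology f l sequentially"
  then obtain l where l: "limitin mackey_dual_topology f l sequentially" by blast
  have ev: "eventually (\<lambda>n. f n \<in> (+) l ` U) sequentially" if "openin mackey_dual_topology U" "0 \<in> U" for U
  proof -
    have "l \<in> (+) l ` U" using that(2) by (intro image_eqI[of _ _ 0]) auto
    then show ?thesis using l openin_mackey_translation[OF that(1), of l] by (auto simp: limitin_def)
  qed
  have "precompact_in mackey_dual_topology (range f)"
    unfolding precompact_in_def
  proof (intro allI impI)
    fix U :: "('a \<Rightarrow>\<^sub>L real) set" assume U: "openin mackey_dual_topology U \<and> 0 \<in> U"
    then obtain N where N: "\<And>n. n \<ge> N \<Longrightarrow> f n \<in> (+) l ` U"
      using ev[of U] unfolding eventually_sequentially by blast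
    have self: "f n \<in> (+) (f n) ` U" for n using U by (intro image_eqI[of _ _ 0]) auto
    have "range f \<subseteq> (\<Union>x\<in>insert l (f ` {..<N}). (+) x ` U)"
    proof
      fix z assume "z \<in> range f"
      then obtain n where "z = f n" by blast
      then show "z \<in> (\<Union>x\<in>insert l (f ` {..<N}). (+) x ` U)"
        using N[of n] self[of n] by (cases "N \<le> n") auto
    qed
    then show "\<exists>F. finite F \<and> range f \<subseteq> (\<Union>x\<in>F. (+) x ` U)"
      by (intro exI[of _ "insert l (f ` {..<N})"]) auto
  qed
  then have tb: "\<exists>F. finite F \<and> range f \<subseteq> (\<Union>x\<in>F. ball x e)" if "e > 0" for e
    using pc that unfolding precompact_in_euclidean by blast
  have pw: "(\<lambda>n. f n x) \<longlonglongrightarrow> l x" for x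
  proof (rule tendstoI)
    fix e :: real assume "e > 0"
    obtain K where K: "compactin weak_topology K" "absolutely_convex K" "x \<in> K"
      by (rule weakly_compact_absolutely_convex_contains)
    from ev[OF openin_mackey_polar[OF K(1,2)] zero_in_polar[OF \<open>e > 0\<close>]]
    show "eventually (\<lambda>n. dist (f n x) (l x) < e) sequentially"
      by eventually_elim (use K(3) in \<open>force simp: blinfun.add_left dist_real_def\<close>)
  qed
  have "f \<longlonglongrightarrow> l"
  proof (rule tendstoI)
    fix e :: real assume "e > 0"
    then obtain F where F: "finite F" "range f \<subseteq> (\<Union>x\<in>F. ball x (e / 3))" using tb[of "e / 3"] by auto
    \<comment> \<open>Centres whose balls are visited infinitely often lie within e / 3 of
      \<open>l\<close>, because norm bounds survive pointwise limits; the balls of the other centres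
      are eventually avoided.\<close>
    define F' where "F' = {\<phi>\<in>F. frequently (\<lambda>n. f n \<in> ball \<phi> (e / 3)) sequentially}"
    have near: "norm (\<phi> - l) \<le> e / 3" if "\<phi> \<in> F'" for \<phi>
    proof (rule norm_blinfun_bound)
      fix x
      have fr: "frequently (\<lambda>n. norm ((\<phi> - f n) x) \<le> e / 3 * norm x) sequentially"
      proof (rule frequently_elim1)
        show "frequently (\<lambda>n. f n \<in> ball \<phi> (e / 3)) sequentially" using that by (simp add: F'_def)
        fix n assume "f n \<in> ball \<phi> (e / 3)"
        then have "norm (\<phi> - f n) * norm x \<le> e / 3 * norm x"
          by (intro mult_right_mono) (auto simp: dist_norm)
        then show "norm ((\<phi> - f n) x) \<le> e / 3 * norm x"
          using norm_blinfun[of "\<phi> - f n" x] by linarith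
      qed
      have lim: "(\<lambda>n. norm ((\<phi> - f n) x)) \<longlonglongrightarrow> norm ((\<phi> - l) x)"
        unfolding blinfun.diff_left by (intro tendsto_intros pw)
      show "norm ((\<phi> - l) x) \<le> e / 3 * norm x"
      proof (rule ccontr)
        assume "\<not> ?thesis"
        then have "eventually (\<lambda>n. e / 3 * norm x < norm ((\<phi> - f n) x)) sequentially"
          by (intro order_tendstoD(1)[OF lim]) simp
        with fr have "frequently (\<lambda>n. norm ((\<phi> - f n) x) \<le> e / 3 * norm x \<and>
            e / 3 * norm x < norm ((\<phi> - f n) x)) sequentially"
          by (rule frequently_eventually_frequently)
        then show False by (auto dest!: frequently_ex)
      qed
    qed (use \<open>e > 0\<close> in simp)
    have "eventually (\<lambda>n. \<forall>\<phi>\<in>F - F'. f n \<notin> ball \<phi> (e / 3)) sequentially"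
      using F(1) by (intro eventually_ball_finite) (auto simp: F'_def not_frequently)
    then show "eventually (\<lambda>n. dist (f n) l < e) sequentially"
    proof eventually_elim
      case (elim n)
      then obtain \<phi> where \<phi>: "\<phi> \<in> F'" "f n \<in> ball \<phi> (e / 3)" using F(2) by fastforce
      have "dist (f n) l \<le> dist (f n) \<phi> + dist \<phi> l" by (rule dist_triangle)
      also have "\<dots> < e" using \<phi>(2) near[OF \<phi>(1)] \<open>e > 0\<close> by (simp add: dist_norm norm_minus_commute)
      finally show ?case .
    qed
  qed
  then show "convergent f" by (auto simp: convergent_def)
qed

section \<open>Sequential reflexivity implies equal precompact sets\<close>

text \<open>The sequence lies in one weakly compact absolutely convex \<open>K\<close>. Up to a
  polar of \<open>K\<close> the set \<open>S\<close> is replaced by finitely many functionals, each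
  of which is small on the tail.\<close>

lemma mackey_precompact_uniform_weakly_null:
  fixes S :: "('a::banach \<Rightarrow>\<^sub>L real) set"
  assumes S: "precompact_in mackey_dual_topology S"
    and bd: "\<And>n. norm (y n) \<le> B" and null: "\<And>f :: 'a \<Rightarrow>\<^sub>L real. (\<lambda>n. f (y n)) \<longlonglongrightarrow> 0"
    and e: "e > 0"
  shows "eventually (\<lambda>n. \<forall>f\<in>S. \<bar>blinfun_apply f (y n)\<bar> \<le> e) sequentially"
proof -
  obtain K where K: "compactin weak_topology K" "absolutely_convex K" "range y \<subseteq> K"
    using weakly_null_sequence_in_weakly_compact[OF bd null] by blast
  define U where "U = {f :: 'a \<Rightarrow>\<^sub>L real. \<exists>d<e/2. \<forall>x\<in>K. \<bar>blinfun_apply f x\<bar> \<le> d}"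
  have "openin mackey_dual_topology U" "0 \<in> U"
    unfolding U_def using e by (intro openin_mackey_polar[OF K(1,2)] zero_in_polar; simp)+
  then obtain F where F: "finite F" "S \<subseteq> (\<Union>x\<in>F. (+) x ` U)"
    using S unfolding precompact_in_def by blast
  have "eventually (\<lambda>n. \<forall>f\<in>F. \<bar>blinfun_apply f (y n)\<bar> < e / 2) sequentially"
    using F(1) tendstoD[OF null, of "e / 2"] e by (intro eventually_ball_finite) auto
  then show ?thesis
  proof eventually_elim
    case (elim n)
    show ?case
    proof
      fix f assume "f \<in> S"
      then obtain g u where gu: "g \<in> F" "u \<in> U" "f = g + u" using F(2) by blast
      then obtain d where "d < e / 2" "\<bar>blinfun_apply u (y n)\<bar> \<le> d" using K(3) by (auto simp: U_def)
      then show "\<bar>blinfun_apply f (y n)\<bar> \<le> e"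
        using elim gu by (force simp: blinfun.add_left)
    qed
  qed
qed

text \<open>If \<open>Y\<close> were a net of the unit ball for the supremum over \<open>S\<close>,
  the members of \<open>S\<close> would be determined in norm, up to less than e, by their
  approximate values on \<open>Y\<close>; precompactness leaves finitely many cases for
  these.\<close>

lemma mackey_precompact_separated_points:
  fixes S :: "('a::banach \<Rightarrow>\<^sub>L real) set"
  assumes S: "precompact_in mackey_dual_topology S" and e: "e > 0"
    and cov: "\<not> (\<exists>F. finite F \<and> S \<subseteq> (\<Union>f\<in>F. ball f e))" and Y: "finite Y"
  shows "\<exists>x. norm x \<le> 1 \<and> (\<forall>y\<in>Y. \<exists>f\<in>S. e / 4 < \<bar>blinfun_apply f (x - y)\<bar>)"
proof (rule ccontr)
  assume "\<not> ?thesis"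
  then have neg: "\<And>x. norm x \<le> 1 \<Longrightarrow> \<exists>y\<in>Y. \<forall>f\<in>S. \<bar>blinfun_apply f (x - y)\<bar> \<le> e / 4"
    by (auto simp: not_less)
  have "\<exists>U. openin mackey_dual_topology U \<and> (0 :: 'a \<Rightarrow>\<^sub>L real) \<in> U \<and> (\<forall>f\<in>U. \<forall>y\<in>Y. \<bar>blinfun_apply f y\<bar> \<le> e / 16)"
    using Y
  proof (induction Y rule: finite_induct)
    case empty
    then show ?case using openin_topspace[of mackey_dual_topology] by (intro exI[of _ UNIV]) simp
  next
    case (insert y Y)
    then obtain U where U: "openin mackey_dual_topology U" "(0 :: 'a \<Rightarrow>\<^sub>L real) \<in> U"
      "\<forall>f\<in>U. \<forall>y\<in>Y. \<bar>blinfun_apply f y\<bar> \<le> e / 16" by blast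
    obtain K where K: "compactin weak_topology K" "absolutely_convex K" "y \<in> K"
      by (rule weakly_compact_absolutely_convex_contains)
    let ?P = "{f :: 'a \<Rightarrow>\<^sub>L real. \<exists>d<e/16. \<forall>x\<in>K. \<bar>blinfun_apply f x\<bar> \<le> d}"
    have "openin mackey_dual_topology (U \<inter> ?P)"
      by (intro openin_Int U openin_mackey_polar K)
    moreover have "0 \<in> U \<inter> ?P" using U(2) zero_in_polar[of "e / 16"] e by simp
    moreover have "\<forall>f\<in>U \<inter> ?P. \<forall>z\<in>insert y Y. \<bar>blinfun_apply f z\<bar> \<le> e / 16" using U(3) K(3) by force
    ultimately show ?case by blast
  qed
  then obtain U where U: "openin mackey_dual_topology U" "(0 :: 'a \<Rightarrow>\<^sub>L real) \<in> U"
    "\<forall>f\<in>U. \<forall>y\<in>Y. \<bar>blinfun_apply f y\<bar> \<le> e / 16" by blast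
  obtain F where F: "finite F" "S \<subseteq> (\<Union>x\<in>F. (+) x ` U)"
    using S U(1,2) unfolding precompact_in_def by blast
  \<comment> \<open>The centres of the cover may lie outside \<open>S\<close>, whereas the estimate
    at \<open>x - y\<close> is for members of \<open>S\<close>; so a centre is replaced by a member
    of \<open>S\<close> in its translate, if there is one.\<close>
  define c where "c f0 = (SOME f. f \<in> S \<inter> (+) f0 ` U)" for f0
  have "S \<subseteq> (\<Union>f\<in>c ` F. ball f e)"
  proof
    fix f assume "f \<in> S"
    then obtain f0 where f0: "f0 \<in> F" "f \<in> S \<inter> (+) f0 ` U" using F(2) by blast
    from f0(2) have c: "c f0 \<in> S \<inter> (+) f0 ` U" unfolding c_def by (rule someI[of "\<lambda>f. f \<in> S \<inter> (+) f0 ` U"])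
    \<comment> \<open>Twice e / 4 from replacing x by y and twice e / 16 from the values at y stay
      below 3 * e / 4, hence below e.\<close>
    have "norm (c f0 - f) \<le> (3 * e / 4) / 1"
    proof (rule blinfun_scaleR_norm_bound)
      fix x :: 'a assume "norm x \<le> 1"
      then obtain y where y: "y \<in> Y" "\<forall>f\<in>S. \<bar>blinfun_apply f (x - y)\<bar> \<le> e / 4" using neg by blast
      obtain u v where uv: "u \<in> U" "v \<in> U" "f = f0 + u" "c f0 = f0 + v" using f0 c by blast
      have "\<bar>blinfun_apply u y\<bar> \<le> e / 16" "\<bar>blinfun_apply v y\<bar> \<le> e / 16" using U(3) y(1) uv by auto
      moreover have "\<bar>blinfun_apply f (x - y)\<bar> \<le> e / 4" "\<bar>blinfun_apply (c f0) (x - y)\<bar> \<le> e / 4"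
        using y(2) c \<open>f \<in> S\<close> by auto
      moreover have "blinfun_apply (c f0 - f) x =
         blinfun_apply (c f0) (x - y) - blinfun_apply f (x - y) + (blinfun_apply v y - blinfun_apply u y)"
        by (simp add: uv blinfun.diff_left blinfun.diff_right blinfun.add_left)
      ultimately show "\<bar>blinfun_apply (c f0 - f) x\<bar> \<le> 3 * e / 4" using e by linarith
    qed simp
    then have "f \<in> ball (c f0) e" using e by (simp add: dist_norm)
    then show "f \<in> (\<Union>f\<in>c ` F. ball f e)" using f0(1) by blast
  qed
  with cov F(1) show False by blast
qed

lemma sequentially_reflexive_imp_precompact:
  fixes S :: "('a::banach \<Rightarrow>\<^sub>L real) set"
  assumes refl: "sequentially_reflexive TYPE('a)" and S: "precompact_in mackey_dual_topology S"
  shows "precompact_in euclidean S"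
proof (rule ccontr)
  assume "\<not> ?thesis"
  then obtain e where e: "e > 0" and cov: "\<not> (\<exists>F. finite F \<and> S \<subseteq> (\<Union>f\<in>F. ball f e))"
    unfolding precompact_in_euclidean by blast
  define ok where "ok = (\<lambda>(x :: 'a, Y :: 'a set). norm x \<le> 1 \<and> finite Y)"
  \<comment> \<open>The set \<open>Y\<close> collects the earlier points and trails the current
    point \<open>x\<close> by one step, hence \<open>insert x Y\<close>.\<close>
  define nxt where "nxt = (\<lambda>(x :: 'a, Y) (x', Y'). Y' = insert x Y \<and>
    (\<forall>y\<in>insert x Y. \<exists>f\<in>S. e / 4 < \<bar>blinfun_apply f (x' - y)\<bar>))"
  have "\<exists>p. \<forall>i::nat. ok (p i) \<and> nxt (p i) (p (Suc i))"
  proof (rule dependent_nat_choice)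
    show "\<exists>z. ok z" by (intro exI[of _ "(0, {})"]) (simp add: ok_def)
  next
    fix z assume "ok z"
    then show "\<exists>z'. ok z' \<and> nxt z z'"
      using mackey_precompact_separated_points[OF S e cov, of "insert (fst z) (snd z)"]
      by (auto simp: ok_def nxt_def split: prod.splits)
  qed
  then obtain p where p: "\<And>i::nat. ok (p i)" "\<And>i. nxt (p i) (p (Suc i))" by blast
  define x where "x i = fst (p i)" for i
  have x1: "norm (x i) \<le> 1" for i using p(1)[of i] by (auto simp: ok_def x_def split: prod.splits)
  have Y: "snd (p (Suc i)) = insert (x i) (snd (p i))"
    "\<And>y. y \<in> snd (p (Suc i)) \<Longrightarrow> \<exists>f\<in>S. e / 4 < \<bar>blinfun_apply f (x (Suc i) - y)\<bar>" for i
    using p(2)[of i] by (auto simp: nxt_def x_def split: prod.splits)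
  have xY: "x i \<in> snd (p (Suc j))" if "i \<le> j" for i j
    using that by (induction rule: dec_induct) (auto simp: Y(1))
  have sep: "\<exists>f\<in>S. e / 4 < \<bar>blinfun_apply f (x j - x i)\<bar>" if "i < j" for i j
    using that xY[of i "j - 1"] Y(2)[of "x i" "j - 1"] by simp
  have div: "\<exists>g\<in>{g :: 'a \<Rightarrow>\<^sub>L real. norm g \<le> 1}. \<not> convergent (\<lambda>i. blinfun_apply g (x (r i)))"
    if r: "strict_mono r" for r :: "nat \<Rightarrow> nat"
  proof (rule ccontr)
    assume neg: "\<not> ?thesis"
    have conv: "convergent (\<lambda>i. blinfun_apply f (x (r i)))" for f :: "'a \<Rightarrow>\<^sub>L real"
    proof (cases "f = 0")
      case True
      then show ?thesis by (simp add: convergent_const)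
    next
      case False
      then have "norm ((1 / norm f) *\<^sub>R f) \<le> 1" by simp
      then have "convergent (\<lambda>i. blinfun_apply ((1 / norm f) *\<^sub>R f) (x (r i)))"
        using neg by blast
      then have "convergent (\<lambda>i. norm f * blinfun_apply ((1 / norm f) *\<^sub>R f) (x (r i)))"
        by (intro convergent_mult convergent_const)
      then show ?thesis using False by (simp add: blinfun.scaleR_left)
    qed
    \<comment> \<open>Consecutive differences of a weakly Cauchy subsequence are weakly null, while
      \<open>sep\<close> keeps each of them above e / 4 at some member of \<open>S\<close>.\<close>
    define y where "y j = x (r (Suc j)) - x (r j)" for j
    have "norm (y j) \<le> 2" for j
      using norm_triangle_ineq4[of "x (r (Suc j))" "x (r j)"] x1[of "r (Suc j)"] x1[of "r j"]
      by (simp add: y_def)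
    moreover have "(\<lambda>j. blinfun_apply f (y j)) \<longlonglongrightarrow> 0" for f :: "'a \<Rightarrow>\<^sub>L real"
    proof -
      obtain L where L: "(\<lambda>i. blinfun_apply f (x (r i))) \<longlonglongrightarrow> L" using conv[of f] by (auto simp: convergent_def)
      from tendsto_diff[OF LIMSEQ_Suc[OF L] L] show ?thesis by (simp add: y_def blinfun.diff_right)
    qed
    ultimately have "eventually (\<lambda>n. \<forall>f\<in>S. \<bar>blinfun_apply f (y n)\<bar> \<le> e / 4) sequentially"
      using e by (intro mackey_precompact_uniform_weakly_null[OF S, of y 2]) auto
    then obtain n where "\<forall>f\<in>S. \<bar>blinfun_apply f (y n)\<bar> \<le> e / 4"
      by (auto simp: eventually_sequentially)
    then show False using sep[of "r n" "r (Suc n)"] r by (force simp: y_def strict_mono_Suc_iff)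
  qed
  have bd: "bounded (range (\<lambda>n. blinfun_apply g (x n)))" if "g \<in> {g :: 'a \<Rightarrow>\<^sub>L real. norm g \<le> 1}" for g
  proof -
    have "\<bar>blinfun_apply g (x n)\<bar> \<le> norm g * 1" for n
      using norm_blinfun[of g "x n"] mult_left_mono[OF x1[of n] norm_ge_zero[of g]] by simp
    then show ?thesis by (auto simp: bounded_iff)
  qed
  obtain a b and n :: "nat \<Rightarrow> nat" where ab: "a < b" and ind:
    "\<And>N \<sigma>. \<exists>g\<in>{g :: 'a \<Rightarrow>\<^sub>L real. norm g \<le> 1}. \<forall>i<N. if \<sigma> i then b \<le> blinfun_apply g (x (n i)) else blinfun_apply g (x (n i)) \<le> a"
    using pointwise_Cauchy_or_independent[of "{g :: 'a \<Rightarrow>\<^sub>L real. norm g \<le> 1}" "\<lambda>n g. blinfun_apply g (x n)", OF bd div]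
    by metis
  have ind': "\<exists>g :: 'a \<Rightarrow>\<^sub>L real. norm g \<le> 1 \<and>
      (\<forall>i<N. if \<sigma> i then b \<le> blinfun_apply g (x (n i)) else blinfun_apply g (x (n i)) \<le> a)" for N \<sigma>
    using ind[where N = N and \<sigma> = \<sigma>] by blast
  have "\<exists>h :: nat \<Rightarrow> 'a \<Rightarrow>\<^sub>L real. (\<forall>C \<epsilon>. compactin weak_topology C \<longrightarrow> 0 < \<epsilon> \<longrightarrow>
      eventually (\<lambda>n. \<forall>y\<in>C. \<bar>blinfun_apply (h n) y\<bar> \<le> \<epsilon>) sequentially) \<and>
      (\<forall>i. (b - a) / 2 \<le> blinfun_apply (h i) (x (n i)))"
    by (rule independent_imp_uniformly_null_sequence[OF ab, of "\<lambda>i. x (n i)", OF ind']) blast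
  then obtain h :: "nat \<Rightarrow> 'a \<Rightarrow>\<^sub>L real" where h:
    "\<And>C \<epsilon>. compactin weak_topology C \<Longrightarrow> 0 < \<epsilon> \<Longrightarrow> eventually (\<lambda>n. \<forall>y\<in>C. \<bar>blinfun_apply (h n) y\<bar> \<le> \<epsilon>) sequentially"
    "\<And>i. (b - a) / 2 \<le> blinfun_apply (h i) (x (n i))"
    by blast
  have "limitin mackey_dual_topology h 0 sequentially"
    unfolding limitin_def
  proof (intro conjI allI impI)
    fix U :: "('a \<Rightarrow>\<^sub>L real) set" assume U: "openin mackey_dual_topology U \<and> 0 \<in> U"
    obtain \<F> \<epsilon> where F: "finite \<F>" "\<forall>K\<in>\<F>. compactin weak_topology K \<and> absolutely_convex K" "\<epsilon> > 0"
      "\<forall>g. (\<forall>K\<in>\<F>. \<forall>x\<in>K. \<bar>blinfun_apply g x - blinfun_apply 0 x\<bar> \<le> \<epsilon>) \<longrightarrow> g \<in> U"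
      using openin_mackeyD[of U 0] U by blast
    have "eventually (\<lambda>n. \<forall>K\<in>\<F>. \<forall>x\<in>K. \<bar>blinfun_apply (h n) x\<bar> \<le> \<epsilon>) sequentially"
      using F(1-3) h(1) by (intro eventually_ball_finite) auto
    then show "eventually (\<lambda>n. h n \<in> U) sequentially"
      by eventually_elim (simp add: F(4))
  qed simp
  then obtain l where l: "h \<longlonglongrightarrow> l"
    using refl unfolding sequentially_reflexive_def convergent_def by blast
  \<comment> \<open>Singletons are weakly compact, so \<open>h\<close> tends to 0 pointwise and its
    norm limit must be 0.\<close>
  have "l y = 0" for y
  proof -
    have "(\<lambda>n. blinfun_apply (h n) y) \<longlonglongrightarrow> 0"
    proof (rule tendstoI)
      fix \<epsilon> :: real assume "\<epsilon> > 0"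
      then have "eventually (\<lambda>n. \<forall>z\<in>{y}. \<bar>blinfun_apply (h n) z\<bar> \<le> \<epsilon> / 2) sequentially"
        by (intro h(1)) (auto intro: finite_imp_compactin)
      then show "eventually (\<lambda>n. dist (blinfun_apply (h n) y) 0 < \<epsilon>) sequentially"
        by eventually_elim (use \<open>\<epsilon> > 0\<close> in auto)
    qed
    moreover have "(\<lambda>n. blinfun_apply (h n) y) \<longlonglongrightarrow> l y"
      using blinfun.tendsto[OF l tendsto_const] .
    ultimately show ?thesis using LIMSEQ_unique by blast
  qed
  then have "l = 0" by (intro blinfun_eqI) simp
  then have "eventually (\<lambda>i. norm (h i) < (b - a) / 2) sequentially"
    using tendstoD[OF l, of "(b - a) / 2"] ab by simp
  then obtain i where i: "norm (h i) < (b - a) / 2" by (auto simp: eventually_sequentially)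
  have "\<bar>blinfun_apply (h i) (x (n i))\<bar> \<le> norm (h i) * 1"
    using norm_blinfun[of "h i" "x (n i)"] mult_left_mono[OF x1[of "n i"] norm_ge_zero[of "h i"]] by simp
  then show False using i h(2)[of i] by linarith
qed

theorem mainTheorem3:
  shows "sequentially_reflexive TYPE('a::banach) \<longleftrightarrow>
    finest_locally_convex_with_same_precompact_sets
      (mackey_dual_topology :: ('a \<Rightarrow>\<^sub>L real) topology)
      (bound_extension (mackey_dual_topology :: ('a \<Rightarrow>\<^sub>L real) topology))"
proof
  assume refl: "sequentially_reflexive TYPE('a)"
  have same: "precompact_in euclidean S \<longleftrightarrow> precompact_in mackey_dual_topology S" for S :: "('a \<Rightarrow>\<^sub>L real) set"
  proof
    have "openin euclidean U" if "openin mackey_dual_topology U" for U :: "('a \<Rightarrow>\<^sub>L real) set"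
      using openin_mackey_imp_open[OF that] by simp
    moreover assume "precompact_in euclidean S"
    ultimately show "precompact_in mackey_dual_topology S"
      unfolding precompact_in_def by blast
  qed (rule sequentially_reflexive_imp_precompact[OF refl])
  \<comment> \<open>By \<open>same\<close>, norm precompact sets are precompact in every competing
    topology, whose open sets are therefore norm open.\<close>
  then show "finest_locally_convex_with_same_precompact_sets
      (mackey_dual_topology :: ('a \<Rightarrow>\<^sub>L real) topology) (bound_extension mackey_dual_topology)"
    unfolding finest_locally_convex_with_same_precompact_sets_def bound_extension_mackey
    using locally_convex_topology_euclidean open_if_precompact_sets_preserved
    by (metis open_openin)
next
  assume "finest_locally_convex_with_same_precompact_sets
      (mackey_dual_topology :: ('a \<Rightarrow>\<^sub>L real) topology) (bound_extension mackey_dual_topology)"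
  then show "sequentially_reflexive TYPE('a)"
    unfolding finest_locally_convex_with_same_precompact_sets_def bound_extension_mackey
    by (intro same_precompact_sets_imp_sequentially_reflexive) blast
qed

end
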